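(* Any connected network of bipartite pure entangled states is genuine multipartite nonlocal (GMNL). Explicitly: let $n\ge 2$ and let $G$ be a finite connected graph with vertex set $[n]=\{1,\dots,n\}$ (the parties $A_1,\dots,A_n$) and edge set $E$. For every edge $k\in E$ joining vertices $i\neq j$, let $|\psi_k\rangle\in\mathcal H_i^k\otimes\mathcal H_j^k$ be a pure entangled state (a unit vector that is not a product vector), where $\mathcal H_i^k$ and $\mathcal H_j^k$ are finite-dimensional complex Hilbert spaces. Let party $A_i$ hold the Hilbert space $\mathcal H_i=\bigotimes_{k\in E_i}\mathcal H_i^k$, where $E_i$ is the set of edges incident to vertex $i$. Then the $n$-partite state $\bigotimes_{k\in E}|\psi_k\rangle\in\mathcal H_1\otimes\cdots\otimes\mathcal H_n$ is GMNL.
   Context: Distributions. An $n$-partite conditional probability distribution $P(\alpha_1\dots\alpha_n|\chi_1\dots\chi_n)$ has, for each party $i\in[n]$, an input $\chi_i$ and an output $\alpha_i$, each ranging over a finite set. Nonsignalling. A conditional distribution for a set $M$ of parties is nonsignalling if, for every party $j\in M$, the marginal obtained by summing over the output $\alpha_j$ does not depend on the input $\chi_j$. (Equivalently, the marginal on any subset of the parties is independent of the inputs of the parties outside that subset.) GMNL distribution. $P$ is genuine multipartite nonlocal (GMNL) if it cannot be written in the form $$P(\alpha_1\dots\alpha_n|\chi_1\dots\chi_n)=\sum_{M}\sum_{\lambda}q_M(\lambda)\,P_M(\{\alpha_i\}_{i\in M}|\{\chi_i\}_{i\in M},\lambda)\,P_{\overline M}(\{\alpha_i\}_{i\in\overline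 M}|\{\chi_i\}_{i\in\overline M},\lambda),$$ where $M$ ranges over the subsets $\emptyset\neq M\subsetneq[n]$, $\overline M=[n]\setminus M$, $\lambda$ ranges over a finite set, $q_M(\lambda)\ge 0$, $\sum_{M,\lambda}q_M(\lambda)=1$, and for every $M$ and $\lambda$ both $P_M(\cdot|\cdot,\lambda)$ and $P_{\overline M}(\cdot|\cdot,\lambda)$ are nonsignalling conditional probability distributions. GMNL state. A state $\rho$ on $\mathcal H_1\otimes\cdots\otimes\mathcal H_n$ (for a pure state $|\Psi\rangle$, $\rho=|\Psi\rangle\langle\Psi|$) is GMNL if there exist local measurements, i.e. for each party $i$ and each input $\chi_i$ in some finite set a POVM $\{E^i_{\alpha_i|\chi_i}\}_{\alpha_i}$ on $\mathcal H_i$ with finitely many outcomes (positive semidefinite operators with $\sum_{\alpha_i}E^i_{\alpha_i|\chi_i}=\mathbb 1$), such that the distribution $P(\alpha_1\dots\alpha_n|\chi_1\dots\chi_n)=\operatorname{tr}\big(\bigotimes_{i=1}^n E^i_{\alpha_i|\chi_i}\,\rho\big)$ is GMNL. *)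

theory Defs
  imports Complex_Main "HOL-Library.FuncSet" "HOL-Library.Nonpos_Ints"
begin

section \<open>Multipartite distributions\<close>

text \<open>Party \<open>i\<close> has output set \<open>A i\<close> and input set \<open>X i\<close>. A conditional distribution
  \<open>P a x\<close> for a set \<open>M\<close> of parties takes the outputs \<open>a \<in> Pi\<^sub>E M A\<close> and the inputs
  \<open>x \<in> Pi\<^sub>E M X\<close>; its values elsewhere are irrelevant.\<close>

type_synonym ('p, 'a, 'x) dist = "('p \<Rightarrow> 'a) \<Rightarrow> ('p \<Rightarrow> 'x) \<Rightarrow> real"

definition cond_dist ::
  "'p set \<Rightarrow> ('p \<Rightarrow> 'a set) \<Rightarrow> ('p \<Rightarrow> 'x set) \<Rightarrow> ('p, 'a, 'x) dist \<Rightarrow> bool" where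
  "cond_dist M A X P \<longleftrightarrow>
     (\<forall>x \<in> Pi\<^sub>E M X. (\<forall>a \<in> Pi\<^sub>E M A. 0 \<le> P a x) \<and> (\<Sum>a \<in> Pi\<^sub>E M A. P a x) = 1)"

definition nonsignalling ::
  "'p set \<Rightarrow> ('p \<Rightarrow> 'a set) \<Rightarrow> ('p \<Rightarrow> 'x set) \<Rightarrow> ('p, 'a, 'x) dist \<Rightarrow> bool" where
  "nonsignalling M A X P \<longleftrightarrow>
     (\<forall>j \<in> M. \<forall>a \<in> Pi\<^sub>E (M - {j}) A. \<forall>x \<in> Pi\<^sub>E M X. \<forall>x' \<in> Pi\<^sub>E M X.
        (\<forall>i \<in> M - {j}. x i = x' i) \<longrightarrow>
        (\<Sum>b \<in> A j. P (a(j := b)) x) = (\<Sum>b \<in> A j. P (a(j := b)) x'))"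

definition ns_dist ::
  "'p set \<Rightarrow> ('p \<Rightarrow> 'a set) \<Rightarrow> ('p \<Rightarrow> 'x set) \<Rightarrow> ('p, 'a, 'x) dist \<Rightarrow> bool" where
  "ns_dist M A X P \<longleftrightarrow> cond_dist M A X P \<and> nonsignalling M A X P"

definition proper_parts :: "'p set \<Rightarrow> 'p set set" where
  "proper_parts N = {M. M \<noteq> {} \<and> M \<subset> N}"

text \<open>The finite range \<open>L\<close> of the hidden variable is, up to relabelling, a set of naturals.
  \<open>PL M l\<close> and \<open>PR M l\<close> are the distributions of the parties in \<open>M\<close> and in \<open>N - M\<close>.\<close>

definition bilocal_decomposable ::
  "'p set \<Rightarrow> ('p \<Rightarrow> 'a set) \<Rightarrow> ('p \<Rightarrow> 'x set) \<Rightarrow> ('p, 'a, 'x) dist \<Rightarrow> bool" where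
  "bilocal_decomposable N A X P \<longleftrightarrow>
     (\<exists>(L :: nat set) (q :: 'p set \<Rightarrow> nat \<Rightarrow> real)
        (PL :: 'p set \<Rightarrow> nat \<Rightarrow> ('p, 'a, 'x) dist) (PR :: 'p set \<Rightarrow> nat \<Rightarrow> ('p, 'a, 'x) dist).
        finite L \<and>
        (\<forall>M \<in> proper_parts N. \<forall>l \<in> L.
           0 \<le> q M l \<and> ns_dist M A X (PL M l) \<and> ns_dist (N - M) A X (PR M l)) \<and>
        (\<Sum>M \<in> proper_parts N. \<Sum>l \<in> L. q M l) = 1 \<and>
        (\<forall>a \<in> Pi\<^sub>E N A. \<forall>x \<in> Pi\<^sub>E N X.
           P a x = (\<Sum>M \<in> proper_parts N. \<Sum>l \<in> L.
             q M l * PL M l (restrict a M) (restrict x M)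
                   * PR M l (restrict a (N - M)) (restrict x (N - M)))))"

text \<open>Meant for conditional distributions \<open>P\<close>; below it is only applied to
  distributions given by the Born rule.\<close>

definition GMNL_dist ::
  "'p set \<Rightarrow> ('p \<Rightarrow> 'a set) \<Rightarrow> ('p \<Rightarrow> 'x set) \<Rightarrow> ('p, 'a, 'x) dist \<Rightarrow> bool" where
  "GMNL_dist N A X P \<longleftrightarrow> \<not> bilocal_decomposable N A X P"

section \<open>Vectors, operators and measurements\<close>

text \<open>A finite-dimensional Hilbert space is given by the index set \<open>S\<close> of an orthonormal basis:
  vectors are coefficient functions on \<open>S\<close> and operators are matrices indexed by \<open>S \<times> S\<close>,
  values outside \<open>S\<close> being irrelevant. If \<open>H i\<close> is the index set of the space of party \<open>i\<close>,
  then the tensor product over \<open>i \<in> N\<close> has index set \<open>Pi\<^sub>E N H\<close>.\<close>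

type_synonym 's cvec = "'s \<Rightarrow> complex"
type_synonym 's cop = "'s \<Rightarrow> 's \<Rightarrow> complex"

definition unit_vector :: "'s set \<Rightarrow> 's cvec \<Rightarrow> bool" where
  "unit_vector S v \<longleftrightarrow> (\<Sum>s \<in> S. (cmod (v s))\<^sup>2) = 1"

definition product_vector :: "'p set \<Rightarrow> ('p \<Rightarrow> 'b set) \<Rightarrow> ('p \<Rightarrow> 'b) cvec \<Rightarrow> bool" where
  "product_vector N H v \<longleftrightarrow>
     (\<exists>u :: 'p \<Rightarrow> 'b cvec. \<forall>y \<in> Pi\<^sub>E N H. v y = (\<Prod>i \<in> N. u i (y i)))"

definition pure_entangled :: "'p set \<Rightarrow> ('p \<Rightarrow> 'b set) \<Rightarrow> ('p \<Rightarrow> 'b) cvec \<Rightarrow> bool" where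
  "pure_entangled N H v \<longleftrightarrow> unit_vector (Pi\<^sub>E N H) v \<and> \<not> product_vector N H v"

definition op_mult :: "'s set \<Rightarrow> 's cop \<Rightarrow> 's cop \<Rightarrow> 's cop" where
  "op_mult S F G = (\<lambda>y z. \<Sum>w \<in> S. F y w * G w z)"

definition op_trace :: "'s set \<Rightarrow> 's cop \<Rightarrow> complex" where
  "op_trace S F = (\<Sum>y \<in> S. F y y)"

definition tensor_op :: "'p set \<Rightarrow> ('p \<Rightarrow> 'b cop) \<Rightarrow> ('p \<Rightarrow> 'b) cop" where
  "tensor_op N F = (\<lambda>y z. \<Prod>i \<in> N. F i (y i) (z i))"

definition projector :: "'s cvec \<Rightarrow> 's cop" where
  "projector v = (\<lambda>y z. v y * cnj (v z))"

definition pos_semidef :: "'s set \<Rightarrow> 's cop \<Rightarrow> bool" where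
  "pos_semidef S F \<longleftrightarrow>
     (\<forall>v :: 's cvec. (\<Sum>y \<in> S. \<Sum>z \<in> S. cnj (v y) * F y z * v z) \<in> \<real>\<^sub>\<ge>\<^sub>0)"

definition povm :: "'s set \<Rightarrow> 'a set \<Rightarrow> ('a \<Rightarrow> 's cop) \<Rightarrow> bool" where
  "povm S A F \<longleftrightarrow>
     (\<forall>\<alpha> \<in> A. pos_semidef S (F \<alpha>)) \<and>
     (\<forall>y \<in> S. \<forall>z \<in> S. (\<Sum>\<alpha> \<in> A. F \<alpha> y z) = (if y = z then 1 else 0))"

text \<open>\<open>F i \<chi> \<alpha>\<close> is the effect of party \<open>i\<close> for input \<open>\<chi>\<close> and output \<open>\<alpha>\<close>. For effects of
  POVMs and a density operator \<open>\<rho>\<close> the trace is real.\<close>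

definition born_dist ::
  "'p set \<Rightarrow> ('p \<Rightarrow> 'b set) \<Rightarrow> ('p \<Rightarrow> 'x \<Rightarrow> 'a \<Rightarrow> 'b cop) \<Rightarrow> ('p \<Rightarrow> 'b) cop \<Rightarrow> ('p, 'a, 'x) dist"
  where
  "born_dist N H F \<rho> = (\<lambda>a x.
     Re (op_trace (Pi\<^sub>E N H) (op_mult (Pi\<^sub>E N H) (tensor_op N (\<lambda>i. F i (x i) (a i))) \<rho>)))"

text \<open>Finite input and output sets are, up to relabelling, sets of naturals.\<close>

definition GMNL_state :: "'p set \<Rightarrow> ('p \<Rightarrow> 'b set) \<Rightarrow> ('p \<Rightarrow> 'b) cop \<Rightarrow> bool" where
  "GMNL_state N H \<rho> \<longleftrightarrow>
     (\<exists>(A :: 'p \<Rightarrow> nat set) (X :: 'p \<Rightarrow> nat set) (F :: 'p \<Rightarrow> nat \<Rightarrow> nat \<Rightarrow> 'b cop).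
        (\<forall>i \<in> N. finite (A i) \<and> finite (X i) \<and> X i \<noteq> {}) \<and>
        (\<forall>i \<in> N. \<forall>\<chi> \<in> X i. povm (H i) (A i) (F i \<chi>)) \<and>
        GMNL_dist N A X (born_dist N H F \<rho>))"

section \<open>Networks\<close>

text \<open>An undirected loopless graph with vertex set \<open>V\<close> and edge set \<open>E\<close>; \<open>ends k\<close> is the
  two-element set of end points of the edge \<open>k\<close>. Parallel edges are allowed; a simple graph
  is the case where \<open>ends\<close> is injective on \<open>E\<close>.\<close>

definition finite_graph :: "'v set \<Rightarrow> 'e set \<Rightarrow> ('e \<Rightarrow> 'v set) \<Rightarrow> bool" where
  "finite_graph V E ends \<longleftrightarrow>
     finite V \<and> finite E \<and> (\<forall>k \<in> E. ends k \<subseteq> V \<and> card (ends k) = 2)"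

definition adjacency :: "'e set \<Rightarrow> ('e \<Rightarrow> 'v set) \<Rightarrow> 'v rel" where
  "adjacency E ends = {(i, j). \<exists>k \<in> E. ends k = {i, j}}"

definition connected_graph :: "'v set \<Rightarrow> 'e set \<Rightarrow> ('e \<Rightarrow> 'v set) \<Rightarrow> bool" where
  "connected_graph V E ends \<longleftrightarrow>
     finite_graph V E ends \<and> V \<noteq> {} \<and> (\<forall>i \<in> V. \<forall>j \<in> V. (i, j) \<in> (adjacency E ends)\<^sup>*)"

definition incident_edges :: "'e set \<Rightarrow> ('e \<Rightarrow> 'v set) \<Rightarrow> 'v \<Rightarrow> 'e set" where
  "incident_edges E ends i = {k \<in> E. i \<in> ends k}"

text \<open>\<open>B i k\<close> indexes a basis of the space that party \<open>i\<close> holds for the incident edge \<open>k\<close>, so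
  the following indexes a basis of the tensor product of these spaces over all edges
  incident to \<open>i\<close>.\<close>

definition party_space ::
  "'e set \<Rightarrow> ('e \<Rightarrow> 'v set) \<Rightarrow> ('v \<Rightarrow> 'e \<Rightarrow> 'b set) \<Rightarrow> 'v \<Rightarrow> ('e \<Rightarrow> 'b) set" where
  "party_space E ends B i = Pi\<^sub>E (incident_edges E ends i) (B i)"

text \<open>The tensor product of the edge states \<open>\<psi> k\<close>, regrouped by parties: \<open>y i k\<close> is the basis
  label at party \<open>i\<close> of its subsystem belonging to \<open>k\<close>.\<close>

definition network_state ::
  "'e set \<Rightarrow> ('e \<Rightarrow> 'v set) \<Rightarrow> ('e \<Rightarrow> ('v \<Rightarrow> 'b) cvec) \<Rightarrow> ('v \<Rightarrow> 'e \<Rightarrow> 'b) cvec" where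
  "network_state E ends \<psi> = (\<lambda>y. \<Prod>k \<in> E. \<psi> k (\<lambda>i \<in> ends k. y i k))"

end

theory Submission
  imports Defs "HOL-Library.Nat_Bijection"
begin

text \<open>Every party uses binary outputs. On a distinguished input it projects its share of every
  edge on a fixed vector, and output \<open>0\<close> means that all projections succeed; on the other inputs
  it measures a single edge. For an edge \<open>{i, j}\<close> joining the two sides of a bipartition, the
  outputs of \<open>i\<close> and \<open>j\<close> are independent in a bilocal component, so a chain of implications
  \<open>a\<^sub>m = 0 \<Longrightarrow> b\<^sub>m\<^sub>+\<^sub>1 = 0\<close>, \<open>b\<^sub>m = 0 \<Longrightarrow> a\<^sub>m\<^sub>+\<^sub>1 = 0\<close> ending in the exclusion of \<open>a\<^sub>N = b\<^sub>N = 0\<close>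
  bounds the probability of \<open>a\<^sub>0 = b\<^sub>0 = 0\<close>, and hence that of global success, by the sum of the
  probabilities of violating a link (Hardy's paradox for \<open>N = 1\<close>, the chained Bell inequality in
  general). Since every bipartition is crossed by an edge of the connected graph, the global
  success probability of a bilocal mixture is at most the sum of the chain errors of all edges. In
  the quantum network it is the product of the success probabilities \<open>h\<^sub>k\<close> of the edges.

  It remains to find for each entangled edge state vectors whose success probability \<open>h\<^sub>k\<close> stays
  fixed while the chain error gets arbitrarily small. Read the state as an antilinear map \<open>J\<close>
  between the two spaces, with transposed map \<open>J'\<close>. If some vector in the range of \<open>J\<close> is not an
  eigenvector of \<open>J J'\<close>, Hardy's paradox has zero error. Otherwise \<open>J J'\<close> is a positive scalar
  on a plane in the range of \<open>J\<close>, and rotating in this plane makes the error \<open>O(1 / N)\<close>.\<close>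

section \<open>Chained Bell inequality for bilocal mixtures\<close>

lemma sum_PiE_partition:
  fixes f g :: "('p \<Rightarrow> 'a) \<Rightarrow> 'c :: comm_semiring_0"
  assumes "M \<subseteq> V"
  shows "(\<Sum>a \<in> Pi\<^sub>E V A. f (restrict a M) * g (restrict a (V - M))) =
    (\<Sum>a \<in> Pi\<^sub>E M A. f a) * (\<Sum>b \<in> Pi\<^sub>E (V - M) A. g b)"
proof -
  have "(\<Sum>a \<in> Pi\<^sub>E V A. f (restrict a M) * g (restrict a (V - M))) =
      (\<Sum>(a, b) \<in> Pi\<^sub>E M A \<times> Pi\<^sub>E (V - M) A. f a * g b)"
    by (rule sum.reindex_bij_witness[of _ "\<lambda>(a, b) v. if v \<in> M then a v else b v"
          "\<lambda>a. (restrict a M, restrict a (V - M))"])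
      (use assms in \<open>auto simp: PiE_iff extensional_def restrict_def fun_eq_iff split: if_splits\<close>)
  also have "\<dots> = (\<Sum>a \<in> Pi\<^sub>E M A. f a) * (\<Sum>b \<in> Pi\<^sub>E (V - M) A. g b)"
    by (simp add: sum_product sum.cartesian_product)
  finally show ?thesis .
qed

lemma restrict_mem_PiE: "a \<in> Pi\<^sub>E V A \<Longrightarrow> M \<subseteq> V \<Longrightarrow> restrict a M \<in> Pi\<^sub>E M A"
  by auto

section \<open>Pair probabilities and chain errors\<close>

definition pair_prob ::
  "'p set \<Rightarrow> ('p \<Rightarrow> 'a set) \<Rightarrow> 'p \<Rightarrow> 'p \<Rightarrow> 'a \<Rightarrow> 'a \<Rightarrow> ('p, 'a, 'x) dist \<Rightarrow> ('p \<Rightarrow> 'x) \<Rightarrow> real"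
  where
  "pair_prob V A i j \<alpha> \<beta> P x = (\<Sum>a \<in> Pi\<^sub>E V A. of_bool (a i = \<alpha> \<and> a j = \<beta>) * P a x)"

text \<open>\<open>e \<alpha> \<beta> m m'\<close> stands for the probability that the first party
  outputs \<open>\<alpha>\<close> on its input number \<open>m\<close> and the second outputs
  \<open>\<beta>\<close> on its input number \<open>m'\<close>. Each summand charges the violation
  of two links, where 0 at \<open>m\<close> on one side forces 0 at \<open>Suc m\<close> on the
  other; the last term charges the pair that closes the chain.\<close>

definition chain_error :: "nat \<Rightarrow> (nat \<Rightarrow> nat \<Rightarrow> nat \<Rightarrow> nat \<Rightarrow> real) \<Rightarrow> real" where
  "chain_error N e = (\<Sum>m<N. e 0 1 m (Suc m) + e 1 0 (Suc m) m) + e 0 0 N N"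

lemma chain_error_cong:
  assumes "\<And>\<alpha> \<beta> m m'. \<alpha> \<le> 1 \<Longrightarrow> \<beta> \<le> 1 \<Longrightarrow> m \<le> N \<Longrightarrow> m' \<le> N \<Longrightarrow> e \<alpha> \<beta> m m' = e' \<alpha> \<beta> m m'"
  shows "chain_error N e = chain_error N e'"
  unfolding chain_error_def using assms by (intro arg_cong2[where f = "(+)"] sum.cong) auto

text \<open>In a chain the outcome 1 occurs only at positive indices, and the comparison is assumed
  only there: index 0 will be the input on which a party measures all its edges at once, where a
  failure cannot be charged to a single edge.\<close>

lemma chain_error_mono:
  assumes "\<And>\<alpha> \<beta> m m'. \<alpha> \<le> 1 \<Longrightarrow> \<beta> \<le> 1 \<Longrightarrow> (\<alpha> = 1 \<longrightarrow> m \<noteq> 0) \<Longrightarrow> (\<beta> = 1 \<longrightarrow> m' \<noteq> 0) \<Longrightarrow>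
    e \<alpha> \<beta> m m' \<le> e' \<alpha> \<beta> m m'"
  shows "chain_error N e \<le> chain_error N e'"
  unfolding chain_error_def by (intro add_mono sum_mono assms) auto

lemma chain_error_sum:
  "chain_error N (\<lambda>\<alpha> \<beta> m m'. \<Sum>c \<in> C. q c * e c \<alpha> \<beta> m m') =
    (\<Sum>c \<in> C. q c * chain_error N (e c))"
proof -
  have "(\<Sum>m<N. (\<Sum>c\<in>C. q c * e c 0 1 m (Suc m)) + (\<Sum>c\<in>C. q c * e c 1 0 (Suc m) m)) =
      (\<Sum>c\<in>C. \<Sum>m<N. q c * (e c 0 1 m (Suc m) + e c 1 0 (Suc m) m))"
    by (subst sum.swap) (simp add: sum.distrib distrib_left)
  then show ?thesis
    unfolding chain_error_def by (simp add: sum.distrib distrib_left sum_distrib_left)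
qed

text \<open>Exchanging the two parties swaps the two families of links, so an edge can be read in
  either direction.\<close>

lemma chain_error_flip:
  "chain_error N (\<lambda>\<alpha> \<beta> m m'. e \<beta> \<alpha> m' m) = chain_error N e"
  by (simp add: chain_error_def add.commute)

text \<open>A union bound for independent events A, B, A', B' with probabilities \<open>f\<close>,
  \<open>g\<close>, \<open>f'\<close>, \<open>g'\<close>: if A and B occur, then A occurs without
  B', or B occurs without A', or A' and B' both occur.\<close>

lemma union_bound_step:
  fixes f g f' g' :: real
  assumes "0 \<le> f" "f \<le> 1" "0 \<le> g" "g \<le> 1" "0 \<le> f'" "f' \<le> 1" "0 \<le> g'" "g' \<le> 1"
  shows "f * g \<le> f * (1 - g') + (1 - f') * g + f' * g'"
proof -
  \<comment> \<open>The excess is split by the four joint values of A' and B'; all weights and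
    coefficients are nonnegative.\<close>
  have "f * (1 - g') + (1 - f') * g + f' * g' - f * g =
      (1 - f') * ((1 - g') * (f * (1 - g) + (1 - f) * g + f * g) + g' * (1 - f) * g)
      + f' * ((1 - g') * f * (1 - g) + g' * (1 - f * g))"
    by algebra
  moreover have "f * g \<le> 1" using assms by (simp add: mult_le_one)
  ultimately show ?thesis using assms by (smt (verit) mult_nonneg_nonneg)
qed

text \<open>Induction on the chain length: \<open>union_bound_step\<close> replaces the closing pair
  \<open>f N * g N\<close> by two further links and the next closing pair.\<close>

lemma chained_local_bound:
  fixes f g :: "nat \<Rightarrow> real"
  assumes "\<And>m. 0 \<le> f m \<and> f m \<le> 1" "\<And>m. 0 \<le> g m \<and> g m \<le> 1"
  shows "f 0 * g 0 \<le> chain_error N (\<lambda>\<alpha> \<beta> m m'.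
    (if \<alpha> = 0 then f m else 1 - f m) * (if \<beta> = 0 then g m' else 1 - g m'))"
proof (induction N)
  case 0
  then show ?case by (simp add: chain_error_def)
next
  case (Suc N)
  have "f N * g N \<le> f N * (1 - g (Suc N)) + (1 - f (Suc N)) * g N + f (Suc N) * g (Suc N)"
    by (intro union_bound_step) (use assms in auto)
  with Suc show ?case by (simp add: chain_error_def)
qed

section \<open>Distributions that factorise across a bipartition\<close>

definition product_dist ::
  "'p set \<Rightarrow> 'p set \<Rightarrow> ('p, 'a, 'x) dist \<Rightarrow> ('p, 'a, 'x) dist \<Rightarrow> ('p, 'a, 'x) dist" where
  "product_dist V M L R a x = L (restrict a M) (restrict x M) * R (restrict a (V - M)) (restrict x (V - M))"

lemma pair_prob_flip: "pair_prob V A j i \<beta> \<alpha> = pair_prob V A i j \<alpha> \<beta>"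
  by (simp add: fun_eq_iff pair_prob_def conj_commute)

text \<open>The new input of \<open>j\<close> is invisible after restriction to \<open>M\<close>,
  and that of \<open>i\<close> after restriction to \<open>V - M\<close>. Hence the joint
  probability factors, and each factor sees only the changed input of its own party.\<close>

lemma pair_prob_product_dist:
  assumes "M \<subseteq> V" "i \<in> M" "j \<in> V - M"
  shows "pair_prob V A i j \<alpha> \<beta> (product_dist V M L R) (x(i := \<chi>, j := \<chi>')) =
    (\<Sum>a \<in> Pi\<^sub>E M A. of_bool (a i = \<alpha>) * L a (restrict (x(i := \<chi>)) M)) *
    (\<Sum>b \<in> Pi\<^sub>E (V - M) A. of_bool (b j = \<beta>) * R b (restrict (x(j := \<chi>')) (V - M)))"
proof -
  let ?x = "x(i := \<chi>, j := \<chi>')"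
  have r: "restrict ?x M = restrict (x(i := \<chi>)) M"
    "restrict ?x (V - M) = restrict (x(j := \<chi>')) (V - M)"
    using assms by (auto simp: restrict_def fun_eq_iff)
  have "pair_prob V A i j \<alpha> \<beta> (product_dist V M L R) ?x =
      (\<Sum>a \<in> Pi\<^sub>E V A. (of_bool (restrict a M i = \<alpha>) * L (restrict a M) (restrict (x(i := \<chi>)) M)) *
        (of_bool (restrict a (V - M) j = \<beta>) * R (restrict a (V - M)) (restrict (x(j := \<chi>')) (V - M))))"
    unfolding pair_prob_def product_dist_def r
    by (rule sum.cong) (use assms in \<open>auto simp: of_bool_def\<close>)
  also have "\<dots> = (\<Sum>a \<in> Pi\<^sub>E M A. of_bool (a i = \<alpha>) * L a (restrict (x(i := \<chi>)) M)) *
    (\<Sum>b \<in> Pi\<^sub>E (V - M) A. of_bool (b j = \<beta>) * R b (restrict (x(j := \<chi>')) (V - M)))"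
    by (rule sum_PiE_partition[OF assms(1)])
  finally show ?thesis .
qed

lemma binary_marginal:
  fixes P :: "('p \<Rightarrow> nat) \<Rightarrow> real"
  assumes "\<And>a. a \<in> Pi\<^sub>E M (\<lambda>_. {0, 1}) \<Longrightarrow> 0 \<le> P a"
    and "(\<Sum>a \<in> Pi\<^sub>E M (\<lambda>_. {0, 1}). P a) = 1" and "i \<in> M"
  defines "f \<equiv> (\<Sum>a \<in> Pi\<^sub>E M (\<lambda>_. {0, 1}). of_bool (a i = 0) * P a)"
  shows "0 \<le> f" "f \<le> 1" "\<And>\<alpha>. \<alpha> \<le> 1 \<Longrightarrow>
    (\<Sum>a \<in> Pi\<^sub>E M (\<lambda>_. {0, 1}). of_bool (a i = \<alpha>) * P a) = (if \<alpha> = 0 then f else 1 - f)"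
proof -
  let ?S = "Pi\<^sub>E M (\<lambda>_. {0, 1 :: nat})"
  let ?g = "\<Sum>a \<in> ?S. of_bool (a i = 1) * P a"
  have "f + ?g = (\<Sum>a \<in> ?S. P a)"
    unfolding f_def sum.distrib[symmetric]
    by (rule sum.cong) (use assms(3) in \<open>auto dest!: PiE_mem[where x = i]\<close>)
  then have g: "?g = 1 - f" using assms(2) by simp
  show "0 \<le> f" unfolding f_def using assms(1) by (intro sum_nonneg) auto
  moreover have "0 \<le> ?g" using assms(1) by (intro sum_nonneg) auto
  ultimately show "f \<le> 1" using g by simp
  show "(\<Sum>a \<in> ?S. of_bool (a i = \<alpha>) * P a) = (if \<alpha> = 0 then f else 1 - f)" if "\<alpha> \<le> 1" for \<alpha>
    using that g by (cases "\<alpha> = 0") (auto simp: f_def le_Suc_eq)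
qed

text \<open>Global success requires that \<open>i\<close> and \<open>j\<close> both output 0; these
  two events are independent, so \<open>chained_local_bound\<close> applies to their
  probabilities.\<close>

lemma product_dist_chain_bound:
  fixes L R :: "('p, nat, 'x) dist"
  assumes "finite V" "M \<subseteq> V" and ij: "i \<in> M" "j \<in> V - M"
    and L: "cond_dist M (\<lambda>_. {0, 1}) X L" and R: "cond_dist (V - M) (\<lambda>_. {0, 1}) X R"
    and z: "z \<in> Pi\<^sub>E V X" and inp: "\<And>m. m \<le> N \<Longrightarrow> inp m \<in> X i \<and> inp m \<in> X j"
    and z0: "z i = inp 0" "z j = inp 0"
  shows "product_dist V M L R (\<lambda>v \<in> V. 0) z \<le>
    chain_error N (\<lambda>\<alpha> \<beta> m m'. pair_prob V (\<lambda>_. {0, 1}) i j \<alpha> \<beta> (product_dist V M L R)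
      (z(i := inp m, j := inp m')))"
proof -
  let ?A = "\<lambda>_. {0, 1 :: nat}"
  \<comment> \<open>\<open>chained_local_bound\<close> asks for probabilities at every index,
    whereas the inputs are known to be valid only up to \<open>N\<close>; beyond it the last one is
    repeated.\<close>
  define inp' where "inp' m = inp (min m N)" for m
  have inp': "inp' m \<in> X i" "inp' m \<in> X j" for m using inp by (auto simp: inp'_def)
  define x where "x m = restrict (z(i := inp' m)) M" for m
  define y where "y m = restrict (z(j := inp' m)) (V - M)" for m
  have x: "x m \<in> Pi\<^sub>E M X" for m
    using z inp' assms(2) by (auto simp: x_def)
  have y: "y m \<in> Pi\<^sub>E (V - M) X" for m
    using z inp' assms(2) by (auto simp: y_def)
  define f where "f m = (\<Sum>a \<in> Pi\<^sub>E M ?A. of_bool (a i = 0) * L a (x m))" for m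
  define g where "g m = (\<Sum>a \<in> Pi\<^sub>E (V - M) ?A. of_bool (a j = 0) * R a (y m))" for m
  have L': "0 \<le> L a (x m)" if "a \<in> Pi\<^sub>E M ?A" for a m
    using L x that unfolding cond_dist_def by blast+
  have L1: "(\<Sum>a \<in> Pi\<^sub>E M ?A. L a (x m)) = 1" for m
    using L x unfolding cond_dist_def by blast
  have R': "0 \<le> R a (y m)" if "a \<in> Pi\<^sub>E (V - M) ?A" for a m
    using R y that unfolding cond_dist_def by blast
  have R1: "(\<Sum>a \<in> Pi\<^sub>E (V - M) ?A. R a (y m)) = 1" for m
    using R y unfolding cond_dist_def by blast
  have fm: "0 \<le> f m" "f m \<le> 1" "\<alpha> \<le> 1 \<Longrightarrow>
      (\<Sum>a \<in> Pi\<^sub>E M ?A. of_bool (a i = \<alpha>) * L a (x m)) = (if \<alpha> = 0 then f m else 1 - f m)" for m \<alpha>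
    unfolding f_def by (intro binary_marginal L' L1 ij; assumption)+
  have gm: "0 \<le> g m" "g m \<le> 1" "\<alpha> \<le> 1 \<Longrightarrow>
      (\<Sum>a \<in> Pi\<^sub>E (V - M) ?A. of_bool (a j = \<alpha>) * R a (y m)) = (if \<alpha> = 0 then g m else 1 - g m)"
    for m \<alpha>
    unfolding g_def by (intro binary_marginal R' R1 ij; assumption)+
  have fin: "finite (Pi\<^sub>E M ?A)" "finite (Pi\<^sub>E (V - M) ?A)"
    using assms(1,2) by (auto intro!: finite_PiE intro: finite_subset)
  have rz: "restrict z M = x 0" "restrict z (V - M) = y 0"
    using z0 by (auto simp: x_def y_def inp'_def restrict_def fun_eq_iff)
  have r0: "restrict (\<lambda>v \<in> V. 0) M = (\<lambda>v \<in> M. 0 :: nat)"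
    "restrict (\<lambda>v \<in> V. 0) (V - M) = (\<lambda>v \<in> V - M. 0 :: nat)"
    using assms(2) by (auto simp: restrict_def fun_eq_iff)
  have "L (\<lambda>v \<in> M. 0) (x 0) \<le> f 0"
    unfolding f_def using ij fin L'
      member_le_sum[of "\<lambda>v \<in> M. 0" "Pi\<^sub>E M ?A" "\<lambda>a. of_bool (a i = 0) * L a (x 0)"] by auto
  moreover have "R (\<lambda>v \<in> V - M. 0) (y 0) \<le> g 0"
    unfolding g_def using ij fin R'
      member_le_sum[of "\<lambda>v \<in> V - M. 0" "Pi\<^sub>E (V - M) ?A" "\<lambda>a. of_bool (a j = 0) * R a (y 0)"] by auto
  moreover have "0 \<le> R (\<lambda>v \<in> V - M. 0) (y 0)" by (rule R') auto
  ultimately have "product_dist V M L R (\<lambda>v \<in> V. 0) z \<le> f 0 * g 0"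
    unfolding product_dist_def rz r0 using fm(1) by (intro mult_mono) auto
  also have "\<dots> \<le> chain_error N (\<lambda>\<alpha> \<beta> m m'.
    (if \<alpha> = 0 then f m else 1 - f m) * (if \<beta> = 0 then g m' else 1 - g m'))"
    by (intro chained_local_bound conjI fm gm)
  also have "\<dots> = chain_error N (\<lambda>\<alpha> \<beta> m m'. pair_prob V ?A i j \<alpha> \<beta> (product_dist V M L R)
      (z(i := inp m, j := inp m')))"
  proof (rule chain_error_cong, goal_cases)
    case (1 \<alpha> \<beta> m m')
    then have e: "restrict (z(i := inp m)) M = x m" "restrict (z(j := inp m')) (V - M) = y m'"
      by (simp_all add: x_def y_def inp'_def)
    show ?case
      unfolding pair_prob_product_dist[OF assms(2) ij] e fm(3)[OF 1(1)] gm(3)[OF 1(2)] ..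
  qed
  finally show ?thesis .
qed

text \<open>Which edge crosses the bipartition varies with the component, so in each component the
  chain error of a crossing edge is enlarged to the sum over all edges. That bound is linear in the
  distribution and survives averaging. All chains start from the common input \<open>z\<close>, so a
  single success probability is compared with every one of them.\<close>

lemma not_bilocal_decomposable:
  fixes P :: "('p, nat, 'x) dist"
  assumes "finite V" "finite E"
    and ends: "\<And>k. k \<in> E \<Longrightarrow> ends k = {src k, dst k} \<and> src k \<noteq> dst k \<and> {src k, dst k} \<subseteq> V"
    and cut: "\<And>M. M \<in> proper_parts V \<Longrightarrow> \<exists>k \<in> E. ends k \<inter> M \<noteq> {} \<and> ends k - M \<noteq> {}"
    and z: "z \<in> Pi\<^sub>E V X"
    and inp: "\<And>k m v. k \<in> E \<Longrightarrow> m \<le> N k \<Longrightarrow> v \<in> V \<Longrightarrow> inp k m \<in> X v"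
    and z0: "\<And>k v. k \<in> E \<Longrightarrow> v \<in> V \<Longrightarrow> z v = inp k 0"
    and less: "(\<Sum>k \<in> E. chain_error (N k) (\<lambda>\<alpha> \<beta> m m'.
        pair_prob V (\<lambda>_. {0, 1}) (src k) (dst k) \<alpha> \<beta> P (z(src k := inp k m, dst k := inp k m'))))
      < P (\<lambda>v \<in> V. 0) z"
  shows "\<not> bilocal_decomposable V (\<lambda>_. {0, 1}) X P"
proof
  let ?A = "\<lambda>_. {0, 1 :: nat}"
  let ?a0 = "\<lambda>v \<in> V. 0 :: nat"
  assume "bilocal_decomposable V ?A X P"
  then obtain L :: "nat set" and q PL PR where
    comp0: "\<forall>M \<in> proper_parts V. \<forall>l \<in> L.
      0 \<le> q M l \<and> ns_dist M ?A X (PL M l) \<and> ns_dist (V - M) ?A X (PR M l)"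
    and P: "\<forall>a \<in> Pi\<^sub>E V ?A. \<forall>x \<in> Pi\<^sub>E V X. P a x = (\<Sum>M \<in> proper_parts V. \<Sum>l \<in> L.
             q M l * PL M l (restrict a M) (restrict x M)
                   * PR M l (restrict a (V - M)) (restrict x (V - M)))"
    unfolding bilocal_decomposable_def by (elim exE conjE) (rule that)
  note comp = comp0[rule_format]
  define C where "C = proper_parts V \<times> L"
  define w where "w = (\<lambda>(M, l). q M l)"
  define D where "D = (\<lambda>(M, l). product_dist V M (PL M l) (PR M l))"
  have P': "P a x = (\<Sum>c \<in> C. w c * D c a x)" if "a \<in> Pi\<^sub>E V ?A" "x \<in> Pi\<^sub>E V X" for a x
    using P[rule_format, OF that] by (simp add: C_def w_def D_def sum.cartesian_product product_dist_def
        case_prod_unfold mult.assoc)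
  define err where "err k Q = chain_error (N k) (\<lambda>\<alpha> \<beta> m m'.
      pair_prob V ?A (src k) (dst k) \<alpha> \<beta> Q (z(src k := inp k m, dst k := inp k m')))"
    for k and Q :: "('p, nat, 'x) dist"
  have inpV: "z(src k := inp k m, dst k := inp k m') \<in> Pi\<^sub>E V X"
    if "k \<in> E" "m \<le> N k" "m' \<le> N k" for k m m'
    using z inp ends[OF that(1)] that by (auto simp: PiE_iff extensional_def)
  have errP: "err k P = (\<Sum>c \<in> C. w c * err k (D c))" if "k \<in> E" for k
  proof -
    have "err k P = chain_error (N k) (\<lambda>\<alpha> \<beta> m m'. \<Sum>c \<in> C. w c *
      pair_prob V ?A (src k) (dst k) \<alpha> \<beta> (D c) (z(src k := inp k m, dst k := inp k m')))"
      unfolding err_def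
    proof (rule chain_error_cong, goal_cases)
      case (1 \<alpha> \<beta> m m')
      then show ?case
        unfolding pair_prob_def sum_distrib_left
        by (subst sum.swap, intro sum.cong)
          (use inpV[OF that] in \<open>auto simp: P' sum_distrib_left mult_ac\<close>)
    qed
    then show ?thesis unfolding chain_error_sum err_def .
  qed
  have w: "0 \<le> w c" if "c \<in> C" for c
    using comp that by (auto simp: C_def w_def)
  have bound: "D c ?a0 z \<le> (\<Sum>k \<in> E. err k (D c))" if "c \<in> C" for c
  proof -
    obtain M l where c: "c = (M, l)" "M \<in> proper_parts V" "l \<in> L"
      using \<open>c \<in> C\<close> by (cases c) (simp add: C_def)
    then have M: "M \<subseteq> V" by (auto simp: proper_parts_def)
    have cd: "cond_dist M ?A X (PL M l)" "cond_dist (V - M) ?A X (PR M l)"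
      using comp[OF c(2,3)] by (auto simp: ns_dist_def)
    \<comment> \<open>Nonnegativity allows the errors of the remaining edges to be added to that of
      a crossing edge.\<close>
    have pos: "0 \<le> err k (D c)" if k: "k \<in> E" for k
    proof -
      have "0 \<le> D c a x" if "a \<in> Pi\<^sub>E V ?A" "x \<in> Pi\<^sub>E V X" for a x
      proof -
        have "restrict a M \<in> Pi\<^sub>E M ?A" "restrict a (V - M) \<in> Pi\<^sub>E (V - M) ?A"
          "restrict x M \<in> Pi\<^sub>E M X" "restrict x (V - M) \<in> Pi\<^sub>E (V - M) X"
          using that M by (simp_all only: restrict_mem_PiE Diff_subset)
        with cd show ?thesis unfolding D_def c product_dist_def cond_dist_def
          by (auto intro!: mult_nonneg_nonneg)
      qed
      then have "0 \<le> pair_prob V ?A (src k) (dst k) \<alpha> \<beta> (D c) (z(src k := inp k m, dst k := inp k m'))"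
        if "m \<le> N k" "m' \<le> N k" for \<alpha> \<beta> m m'
        unfolding pair_prob_def using inpV[OF k that] by (intro sum_nonneg) auto
      then show ?thesis unfolding err_def chain_error_def
        by (intro add_nonneg_nonneg sum_nonneg) auto
    qed
    obtain k where k: "k \<in> E" and cr: "src k \<in> M \<and> dst k \<in> V - M \<or> dst k \<in> M \<and> src k \<in> V - M"
      using cut[OF c(2)] ends by fastforce
    have sd: "src k \<in> V" "dst k \<in> V" "src k \<noteq> dst k" using ends[OF k] by auto
    have "D c ?a0 z \<le> err k (D c)"
      using cr
    proof
      assume "src k \<in> M \<and> dst k \<in> V - M"
      then show ?thesis unfolding err_def D_def c
        using product_dist_chain_bound[OF assms(1) M _ _ cd z, of "src k" "dst k" "N k" "inp k"]
          inp[OF k] z0[OF k] sd by simp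
    next
      assume "dst k \<in> M \<and> src k \<in> V - M"
      then have "D c ?a0 z \<le> chain_error (N k) (\<lambda>\<alpha> \<beta> m m'.
          pair_prob V ?A (dst k) (src k) \<alpha> \<beta> (D c) (z(dst k := inp k m, src k := inp k m')))"
        unfolding D_def c
        using product_dist_chain_bound[OF assms(1) M _ _ cd z, of "dst k" "src k" "N k" "inp k"]
          inp[OF k] z0[OF k] sd by simp
      also have "\<dots> = err k (D c)"
        unfolding err_def
        by (subst chain_error_flip[symmetric])
          (simp only: pair_prob_flip[of V ?A "dst k" "src k"] fun_upd_twist[OF sd(3)])
      finally show ?thesis .
    qed
    also have "\<dots> \<le> (\<Sum>k \<in> E. err k (D c))"
      using pos assms(2) k by (intro member_le_sum) auto
    finally show ?thesis .
  qed
  have "P ?a0 z = (\<Sum>c \<in> C. w c * D c ?a0 z)"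
    by (rule P') (use z in auto)
  also have "\<dots> \<le> (\<Sum>c \<in> C. w c * (\<Sum>k \<in> E. err k (D c)))"
    by (intro sum_mono mult_left_mono bound w)
  also have "\<dots> = (\<Sum>k \<in> E. err k P)"
    by (simp add: errP sum_distrib_left) (rule sum.swap)
  finally show False using less by (simp add: err_def)
qed

text \<open>A path from a vertex of \<open>M\<close> to a vertex outside must leave \<open>M\<close>
  along some edge.\<close>

lemma connected_graph_cut:
  assumes "connected_graph V E ends" "M \<in> proper_parts V"
  shows "\<exists>k \<in> E. ends k \<inter> M \<noteq> {} \<and> ends k - M \<noteq> {}"
proof -
  from assms obtain i j where ij: "i \<in> M" "j \<in> V" "j \<notin> M" "i \<in> V"
    by (auto simp: proper_parts_def)
  then have "(i, j) \<in> (adjacency E ends)\<^sup>*"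
    using assms(1) by (auto simp: connected_graph_def)
  then have "\<exists>u v. u \<in> M \<and> v \<notin> M \<and> (u, v) \<in> adjacency E ends"
    using ij(3) by (induction rule: rtrancl_induct) (use ij(1) in blast)+
  then show ?thesis by (fastforce simp: adjacency_def)
qed

section \<open>Projections and product measurements\<close>

definition expval :: "'s set \<Rightarrow> 's cop \<Rightarrow> 's cvec \<Rightarrow> complex" where
  "expval S F v = (\<Sum>y \<in> S. \<Sum>z \<in> S. cnj (v y) * F y z * v z)"

definition id_op :: "'s cop" where
  "id_op = (\<lambda>y z. if y = z then 1 else 0)"

definition diff_op :: "'s cop \<Rightarrow> 's cop \<Rightarrow> 's cop" where
  "diff_op F G = (\<lambda>y z. F y z - G y z)"

text \<open>Dividing by the squared norm admits unnormalised vectors. If \<open>a\<close> vanishes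
  on \<open>S\<close>, division by zero gives the zero operator, so this is a projection for every
  \<open>a\<close>.\<close>

definition proj_on :: "'s set \<Rightarrow> 's cvec \<Rightarrow> 's cop" where
  "proj_on S a = (\<lambda>y z. a y * cnj (a z) / of_real (\<Sum>s \<in> S. (cmod (a s))\<^sup>2))"

definition is_projection :: "'s set \<Rightarrow> 's cop \<Rightarrow> bool" where
  "is_projection S F \<longleftrightarrow> (\<forall>y \<in> S. \<forall>z \<in> S.
     F z y = cnj (F y z) \<and> (\<Sum>w \<in> S. F y w * F w z) = F y z)"

lemma is_projectionD:
  assumes "is_projection S F" "y \<in> S" "z \<in> S"
  shows "cnj (F y z) = F z y" "(\<Sum>w \<in> S. F y w * F w z) = F y z"
  using assms unfolding is_projection_def by metis+

lemma expval_cong: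
  assumes "\<And>y z. y \<in> S \<Longrightarrow> z \<in> S \<Longrightarrow> F y z = G y z" "\<And>y. y \<in> S \<Longrightarrow> u y = v y"
  shows "expval S F u = expval S G v"
  unfolding expval_def by (intro sum.cong refl) (simp add: assms)

lemma expval_diff_op: "expval S (diff_op F G) v = expval S F v - expval S G v"
  by (simp add: expval_def diff_op_def algebra_simps sum_subtractf)

lemma expval_id_op:
  assumes "finite S"
  shows "expval S id_op v = of_real (\<Sum>s \<in> S. (cmod (v s))\<^sup>2)"
proof -
  have "(\<Sum>z \<in> S. cnj (v y) * id_op y z * v z) = of_real ((cmod (v y))\<^sup>2)" if "y \<in> S" for y
  proof -
    have "(\<Sum>z \<in> S. cnj (v y) * id_op y z * v z) = (\<Sum>z \<in> S. if y = z then cnj (v z) * v z else 0)"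
      by (intro sum.cong refl) (simp add: id_op_def)
    also have "\<dots> = cnj (v y) * v y" using assms that by simp
    finally show ?thesis by (simp only: complex_norm_square mult.commute)
  qed
  then show ?thesis by (simp add: expval_def)
qed

text \<open>Since F is Hermitian and idempotent, its quadratic form at v is the squared norm of F
  v.\<close>

lemma expval_projection:
  assumes "is_projection S F"
  shows "expval S F v = of_real (\<Sum>w \<in> S. (cmod (\<Sum>z \<in> S. F w z * v z))\<^sup>2)"
proof -
  have "of_real (\<Sum>w \<in> S. (cmod (\<Sum>z \<in> S. F w z * v z))\<^sup>2) =
      (\<Sum>w \<in> S. (\<Sum>y \<in> S. cnj (F w y * v y)) * (\<Sum>z \<in> S. F w z * v z))"
    by (simp only: of_real_sum complex_norm_square cnj_sum mult.commute)
  also have "\<dots> = (\<Sum>w \<in> S. \<Sum>y \<in> S. \<Sum>z \<in> S. cnj (v y) * (F y w * F w z) * v z)"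
    unfolding sum_product
    by (intro sum.cong refl) (simp add: is_projectionD[OF assms] mult_ac)
  also have "\<dots> = (\<Sum>y \<in> S. \<Sum>w \<in> S. \<Sum>z \<in> S. cnj (v y) * (F y w * F w z) * v z)"
    by (rule sum.swap)
  also have "\<dots> = (\<Sum>y \<in> S. \<Sum>z \<in> S. \<Sum>w \<in> S. cnj (v y) * (F y w * F w z) * v z)"
    by (rule sum.cong[OF refl]) (rule sum.swap)
  also have "\<dots> = expval S F v"
    unfolding expval_def sum_distrib_left[symmetric] sum_distrib_right[symmetric]
    by (intro sum.cong refl) (simp add: is_projectionD[OF assms])
  finally show ?thesis by simp
qed

lemma pos_semidef_projection:
  assumes "is_projection S F"
  shows "pos_semidef S F"
  unfolding pos_semidef_def expval_def[symmetric] expval_projection[OF assms]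
  by (simp add: sum_nonneg del: of_real_sum)

lemma is_projection_id_op:
  assumes "finite S"
  shows "is_projection S id_op"
  unfolding is_projection_def
proof (intro ballI conjI)
  fix y z :: 'a assume "y \<in> S" "z \<in> S"
  have "(\<Sum>w \<in> S. id_op y w * id_op w z) = (\<Sum>w \<in> S. if y = w then id_op w z else 0)"
    by (intro sum.cong refl) (simp add: id_op_def)
  then show "(\<Sum>w \<in> S. id_op y w * id_op w z) = id_op y z"
    using assms \<open>y \<in> S\<close> by simp
qed (simp add: id_op_def)

lemma is_projection_complement:
  assumes "finite S" "is_projection S F"
  shows "is_projection S (diff_op id_op F)"
  unfolding is_projection_def
proof (intro ballI conjI)
  fix y z assume yz: "y \<in> S" "z \<in> S"
  then show "diff_op id_op F z y = cnj (diff_op id_op F y z)"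
    using is_projectionD[OF assms(2) yz] by (simp add: diff_op_def id_op_def)
  have "(\<Sum>w \<in> S. diff_op id_op F y w * diff_op id_op F w z) =
      (\<Sum>w \<in> S. (if y = w then id_op w z - F w z else 0) - (if w = z then F y w else 0) + F y w * F w z)"
    by (intro sum.cong refl) (auto simp: diff_op_def id_op_def algebra_simps)
  also have "\<dots> = (\<Sum>w \<in> S. if y = w then id_op w z - F w z else 0)
      - (\<Sum>w \<in> S. if w = z then F y w else 0) + (\<Sum>w \<in> S. F y w * F w z)"
    by (simp add: sum.distrib sum_subtractf)
  also have "\<dots> = diff_op id_op F y z"
    using assms(1) yz is_projectionD[OF assms(2) yz] by (simp add: diff_op_def)
  finally show "(\<Sum>w \<in> S. diff_op id_op F y w * diff_op id_op F w z) = diff_op id_op F y z" .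
qed

lemma is_projection_proj_on:
  assumes "finite S"
  shows "is_projection S (proj_on S a)"
  unfolding is_projection_def
proof (intro ballI conjI)
  fix y z assume yz: "y \<in> S" "z \<in> S"
  show "proj_on S a z y = cnj (proj_on S a y z)"
    by (simp add: proj_on_def mult.commute)
  define n where "n = complex_of_real (\<Sum>s \<in> S. (cmod (a s))\<^sup>2)"
  have n: "n = (\<Sum>w \<in> S. cnj (a w) * a w)"
    unfolding n_def by (simp only: of_real_sum complex_norm_square mult.commute)
  have "(\<Sum>w \<in> S. proj_on S a y w * proj_on S a w z) =
      (\<Sum>w \<in> S. a y * cnj (a z) / (n * n) * (cnj (a w) * a w))"
    unfolding proj_on_def n_def[symmetric] by (intro sum.cong refl) (simp add: mult_ac)
  also have "\<dots> = a y * cnj (a z) / (n * n) * n"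
    unfolding n sum_distrib_left ..
  also have "\<dots> = proj_on S a y z"
    by (simp add: proj_on_def n_def[symmetric] del: of_real_sum)
  finally show "(\<Sum>w \<in> S. proj_on S a y w * proj_on S a w z) = proj_on S a y z" .
qed

lemma is_projection_tensor_op:
  assumes "finite N" "\<And>i. i \<in> N \<Longrightarrow> finite (H i)" "\<And>i. i \<in> N \<Longrightarrow> is_projection (H i) (F i)"
  shows "is_projection (Pi\<^sub>E N H) (tensor_op N F)"
  unfolding is_projection_def
proof (intro ballI conjI)
  fix y z assume yz: "y \<in> Pi\<^sub>E N H" "z \<in> Pi\<^sub>E N H"
  then have m: "y i \<in> H i" "z i \<in> H i" if "i \<in> N" for i using that by auto
  show "tensor_op N F z y = cnj (tensor_op N F y z)"
    unfolding tensor_op_def cnj_prod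
    by (intro prod.cong refl) (simp add: is_projectionD[OF assms(3)] m)
  have "(\<Sum>w \<in> Pi\<^sub>E N H. tensor_op N F y w * tensor_op N F w z) =
      (\<Sum>w \<in> Pi\<^sub>E N H. \<Prod>i \<in> N. F i (y i) (w i) * F i (w i) (z i))"
    by (simp add: tensor_op_def prod.distrib)
  also have "\<dots> = (\<Prod>i \<in> N. \<Sum>w \<in> H i. F i (y i) w * F i w (z i))"
    by (rule prod_sum_PiE[symmetric]) (use assms in auto)
  also have "\<dots> = tensor_op N F y z"
    unfolding tensor_op_def
    by (intro prod.cong refl) (simp add: is_projectionD[OF assms(3)] m)
  finally show "(\<Sum>w \<in> Pi\<^sub>E N H. tensor_op N F y w * tensor_op N F w z) = tensor_op N F y z" .
qed

text \<open>The upper bound is positivity of the complementary projection, whose expectation is 1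
  minus that of \<open>F\<close>.\<close>

lemma expval_projection_bounds:
  assumes "finite S" "is_projection S F" "unit_vector S v"
  shows "expval S F v = of_real (Re (expval S F v))" "0 \<le> Re (expval S F v)" "Re (expval S F v) \<le> 1"
proof -
  show "expval S F v = of_real (Re (expval S F v))" "0 \<le> Re (expval S F v)"
    by (simp_all add: expval_projection[OF assms(2)] sum_nonneg del: of_real_sum)
  have "0 \<le> Re (expval S (diff_op id_op F) v)"
    by (simp add: expval_projection[OF is_projection_complement[OF assms(1,2)]] sum_nonneg
        del: of_real_sum)
  moreover have "expval S id_op v = 1"
    using assms(3) by (simp add: expval_id_op[OF assms(1)] unit_vector_def del: of_real_sum)
  ultimately show "Re (expval S F v) \<le> 1" by (simp add: expval_diff_op)
qed

lemma tensor_op_id_op: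
  assumes "finite N" "y \<in> Pi\<^sub>E N H" "z \<in> Pi\<^sub>E N H"
  shows "tensor_op N (\<lambda>_. id_op) y z = id_op y z"
proof (cases "y = z")
  case False
  then obtain i where "i \<in> N" "y i \<noteq> z i" using assms by (metis PiE_ext)
  with False assms(1) show ?thesis by (auto simp: tensor_op_def id_op_def)
qed (simp add: tensor_op_def id_op_def)

lemma tensor_op_cong:
  assumes "\<And>i. i \<in> N \<Longrightarrow> F i (y i) (z i) = G i (y i) (z i)"
  shows "tensor_op N F y z = tensor_op N G y z"
  unfolding tensor_op_def by (intro prod.cong refl assms)

lemma tensor_op_diff_op:
  assumes "finite N" "j \<in> N"
  shows "tensor_op N (F(j := diff_op X Y)) =
    diff_op (tensor_op N (F(j := X))) (tensor_op N (F(j := Y)))"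
proof -
  have "tensor_op N (F(j := Z)) y z = Z (y j) (z j) * (\<Prod>i \<in> N - {j}. F i (y i) (z i))" for Z y z
    unfolding tensor_op_def using assms by (simp add: prod.remove)
  then show ?thesis by (simp add: diff_op_def fun_eq_iff algebra_simps)
qed

lemma povm_binary_projection:
  assumes "finite S" "is_projection S F"
  shows "povm S {0, 1 :: nat} (\<lambda>\<alpha>. if \<alpha> = 0 then F else diff_op id_op F)"
proof -
  have "(\<Sum>\<alpha> \<in> {0, 1 :: nat}. (if \<alpha> = 0 then F else diff_op id_op F) y z) = id_op y z" for y z
    by (simp add: diff_op_def)
  then show ?thesis
    using assms by (simp add: povm_def pos_semidef_projection is_projection_complement)
      (simp add: id_op_def)
qed

section \<open>Born probabilities as expectation values\<close>

lemma born_dist_projector: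
  "born_dist N H F (projector \<Phi>) a x =
    Re (expval (Pi\<^sub>E N H) (tensor_op N (\<lambda>i. F i (x i) (a i))) \<Phi>)"
  by (simp add: born_dist_def op_trace_def op_mult_def projector_def expval_def mult_ac)

text \<open>By multilinearity, weights that factorise over the parties can be moved into the local
  effects. Indicator weights select an output, and constant weight 1 sums a party out.\<close>

lemma born_dist_marginal:
  assumes "finite N" "\<And>i. i \<in> N \<Longrightarrow> finite (A i)"
  shows "(\<Sum>a \<in> Pi\<^sub>E N A. (\<Prod>i \<in> N. w i (a i)) * born_dist N H F (projector \<Phi>) a x) =
    Re (expval (Pi\<^sub>E N H) (tensor_op N (\<lambda>i y z. \<Sum>\<alpha> \<in> A i. of_real (w i \<alpha>) * F i (x i) \<alpha> y z)) \<Phi>)"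
proof -
  have "(\<Sum>a \<in> Pi\<^sub>E N A. of_real (\<Prod>i \<in> N. w i (a i)) * tensor_op N (\<lambda>i. F i (x i) (a i)) y z) =
      tensor_op N (\<lambda>i y z. \<Sum>\<alpha> \<in> A i. of_real (w i \<alpha>) * F i (x i) \<alpha> y z) y z" for y z
    unfolding tensor_op_def of_real_prod prod.distrib[symmetric]
    by (rule prod_sum_PiE[symmetric]) (use assms in auto)
  then have "expval (Pi\<^sub>E N H) (tensor_op N (\<lambda>i y z. \<Sum>\<alpha> \<in> A i. of_real (w i \<alpha>) * F i (x i) \<alpha> y z)) \<Phi> =
      (\<Sum>y \<in> Pi\<^sub>E N H. \<Sum>z \<in> Pi\<^sub>E N H. \<Sum>a \<in> Pi\<^sub>E N A. of_real (\<Prod>i \<in> N. w i (a i)) *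
        (cnj (\<Phi> y) * tensor_op N (\<lambda>i. F i (x i) (a i)) y z * \<Phi> z))"
    unfolding expval_def
    by (simp add: sum_distrib_left sum_distrib_right mult_ac flip: \<open>\<And>z y. _ = tensor_op _ _ y z\<close>)
  also have "\<dots> = (\<Sum>a \<in> Pi\<^sub>E N A. of_real (\<Prod>i \<in> N. w i (a i)) *
      expval (Pi\<^sub>E N H) (tensor_op N (\<lambda>i. F i (x i) (a i))) \<Phi>)"
    unfolding expval_def sum_distrib_left
    by (rule trans[OF _ sum.swap], rule sum.cong[OF refl], rule sum.swap)
  finally show ?thesis by (simp add: born_dist_projector del: of_real_prod)
qed

section \<open>Regrouping the network from parties to edges\<close>

lemma sum_regroup:
  fixes f :: "'e \<Rightarrow> ('v \<Rightarrow> 'b) \<Rightarrow> 'c :: comm_semiring_1"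
  assumes "finite_graph V E ends" "\<And>k i. k \<in> E \<Longrightarrow> i \<in> ends k \<Longrightarrow> finite (B i k)"
  shows "(\<Sum>y \<in> Pi\<^sub>E V (party_space E ends B). \<Prod>k \<in> E. f k (\<lambda>i \<in> ends k. y i k)) =
    (\<Prod>k \<in> E. \<Sum>s \<in> Pi\<^sub>E (ends k) (\<lambda>i. B i k). f k s)"
proof -
  have fin: "finite E" "\<And>k. k \<in> E \<Longrightarrow> ends k \<subseteq> V \<and> finite (ends k)"
    using assms(1) by (auto simp: finite_graph_def intro: finite_subset)
  \<comment> \<open>Both maps transpose the two arguments of a labelling. The restrictions keep only
    incident pairs of vertex and edge, so that the maps are mutually inverse on extensional
    functions.\<close>
  let ?by_edge = "\<lambda>y. \<lambda>k \<in> E. \<lambda>i \<in> ends k. y i k"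
  let ?by_party = "\<lambda>Y. \<lambda>v \<in> V. \<lambda>k \<in> incident_edges E ends v. Y k v"
  have regroup: "(\<lambda>i \<in> ends k. ?by_party Y i k) = Y k"
    if Y: "Y \<in> Pi\<^sub>E E (\<lambda>k. Pi\<^sub>E (ends k) (\<lambda>i. B i k))" and k: "k \<in> E" for Y k
  proof
    fix i show "(\<lambda>i \<in> ends k. ?by_party Y i k) i = Y k i"
      using PiE_arb[OF PiE_mem[OF Y k]] fin(2)[OF k] k
      by (cases "i \<in> ends k") (auto simp: incident_edges_def)
  qed
  have "(\<Prod>k \<in> E. \<Sum>s \<in> Pi\<^sub>E (ends k) (\<lambda>i. B i k). f k s) =
      (\<Sum>Y \<in> Pi\<^sub>E E (\<lambda>k. Pi\<^sub>E (ends k) (\<lambda>i. B i k)). \<Prod>k \<in> E. f k (Y k))"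
    by (rule prod_sum_PiE) (use fin assms(2) in \<open>auto intro!: finite_PiE\<close>)
  also have "\<dots> = (\<Sum>y \<in> Pi\<^sub>E V (party_space E ends B). \<Prod>k \<in> E. f k (\<lambda>i \<in> ends k. y i k))"
  proof (rule sum.reindex_bij_witness[of _ ?by_edge ?by_party], goal_cases)
    case (1 Y)
    show ?case
    proof
      fix k show "?by_edge (?by_party Y) k = Y k"
        using regroup[OF 1] PiE_arb[OF 1] by (cases "k \<in> E") simp_all
    qed
  next
    case (2 Y)
    have "Y k v \<in> B v k" if "k \<in> E" "v \<in> ends k" for k v
      using PiE_mem[OF PiE_mem[OF 2 that(1)] that(2)] .
    then show ?case by (auto simp: party_space_def incident_edges_def)
  next
    case (3 y)
    show ?case
    proof
      fix v show "?by_party (?by_edge y) v = y v"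
      proof (cases "v \<in> V")
        case True
        have "y v \<in> Pi\<^sub>E (incident_edges E ends v) (B v)"
          using PiE_mem[OF 3 True] by (simp add: party_space_def)
        from PiE_arb[OF this] show ?thesis
          using True by (auto simp: fun_eq_iff restrict_def incident_edges_def)
      qed (use PiE_arb[OF 3] in simp)
    qed
  next
    case (4 y)
    have "y v k \<in> B v k" if "k \<in> E" "v \<in> ends k" for k v
    proof -
      have "v \<in> V" using fin(2)[OF that(1)] that(2) by auto
      from PiE_mem[OF 4 this] show ?thesis
        using that by (auto simp: party_space_def incident_edges_def)
    qed
    then show ?case by auto
  next
    case (5 Y)
    show ?case using regroup[OF 5] by (intro prod.cong refl) simp
  qed
  finally show ?thesis by simp
qed

text \<open>Exchanging the product over parties with that over incident edges makes the operator a
  product over edges, like the state; \<open>sum_regroup\<close> then factorises the sums over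
  \<open>y\<close> and \<open>z\<close> in turn.\<close>

lemma network_expval:
  assumes "finite_graph V E ends" "\<And>k i. k \<in> E \<Longrightarrow> i \<in> ends k \<Longrightarrow> finite (B i k)"
  shows "expval (Pi\<^sub>E V (party_space E ends B))
      (tensor_op V (\<lambda>v. tensor_op (incident_edges E ends v) (G v))) (network_state E ends \<psi>) =
    (\<Prod>k \<in> E. expval (Pi\<^sub>E (ends k) (\<lambda>i. B i k)) (tensor_op (ends k) (\<lambda>v. G v k)) (\<psi> k))"
proof -
  let ?S = "Pi\<^sub>E V (party_space E ends B)"
  let ?r = "\<lambda>y k. \<lambda>i \<in> ends k. y i k"
  define t where "t k s s' = cnj (\<psi> k s) * tensor_op (ends k) (\<lambda>v. G v k) s s' * \<psi> k s'" for k s s'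
  have fin: "finite V" "finite E" "\<And>k. k \<in> E \<Longrightarrow> ends k \<subseteq> V"
    using assms(1) by (auto simp: finite_graph_def)
  have "tensor_op V (\<lambda>v. tensor_op (incident_edges E ends v) (G v)) y z =
      (\<Prod>k \<in> E. tensor_op (ends k) (\<lambda>v. G v k) (?r y k) (?r z k))" for y z
  proof -
    have "tensor_op V (\<lambda>v. tensor_op (incident_edges E ends v) (G v)) y z =
        (\<Prod>v \<in> V. \<Prod>k \<in> {k \<in> E. v \<in> ends k}. G v k (y v k) (z v k))"
      by (simp add: tensor_op_def incident_edges_def)
    also have "\<dots> = (\<Prod>k \<in> E. \<Prod>v \<in> {v \<in> V. v \<in> ends k}. G v k (y v k) (z v k))"
      using fin by (intro prod.swap_restrict) auto
    also have "\<dots> = (\<Prod>k \<in> E. tensor_op (ends k) (\<lambda>v. G v k) (?r y k) (?r z k))"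
      unfolding tensor_op_def by (intro prod.cong refl) (use fin(3) in auto)
    finally show ?thesis .
  qed
  moreover have inner: "(\<Sum>z \<in> ?S. \<Prod>k \<in> E. t k (?r y k) (?r z k)) =
      (\<Prod>k \<in> E. \<Sum>s' \<in> Pi\<^sub>E (ends k) (\<lambda>i. B i k). t k (?r y k) s')" for y
    by (rule sum_regroup[OF assms, where f = "\<lambda>k. t k (?r y k)"])
  ultimately have "expval ?S (tensor_op V (\<lambda>v. tensor_op (incident_edges E ends v) (G v))) (network_state E ends \<psi>)
      = (\<Sum>y \<in> ?S. \<Sum>z \<in> ?S. \<Prod>k \<in> E. t k (?r y k) (?r z k))"
    by (simp add: expval_def network_state_def t_def prod.distrib)
  also have "\<dots> = (\<Prod>k \<in> E. \<Sum>s \<in> Pi\<^sub>E (ends k) (\<lambda>i. B i k). \<Sum>s' \<in> Pi\<^sub>E (ends k) (\<lambda>i. B i k). t k s s')"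
    unfolding inner
    by (rule sum_regroup[OF assms, where f = "\<lambda>k s. \<Sum>s' \<in> Pi\<^sub>E (ends k) (\<lambda>i. B i k). t k s s'"])
  finally show ?thesis by (simp add: expval_def t_def)
qed

section \<open>Chains for an entangled pair\<close>

definition ip :: "'s set \<Rightarrow> 's cvec \<Rightarrow> 's cvec \<Rightarrow> complex" where
  "ip S x y = (\<Sum>s \<in> S. cnj (x s) * y s)"

definition norm2 :: "'s set \<Rightarrow> 's cvec \<Rightarrow> real" where
  "norm2 S x = (\<Sum>s \<in> S. (cmod (x s))\<^sup>2)"

text \<open>The unnormalised conditional state of the second party after the first party projects
  on \<open>a\<close>; with the arguments of \<open>\<Psi>\<close> flipped, the parties exchange roles.\<close>

definition steer :: "'s set \<Rightarrow> ('s \<Rightarrow> 't \<Rightarrow> complex) \<Rightarrow> 's cvec \<Rightarrow> 't cvec" where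
  "steer S \<Psi> a = (\<lambda>t. \<Sum>s \<in> S. cnj (a s) * \<Psi> s t)"

definition pair_expval ::
  "'s set \<Rightarrow> 't set \<Rightarrow> ('s \<Rightarrow> 't \<Rightarrow> complex) \<Rightarrow> 's cop \<Rightarrow> 't cop \<Rightarrow> complex" where
  "pair_expval S T \<Psi> F G = (\<Sum>s \<in> S. \<Sum>t \<in> T. \<Sum>s' \<in> S. \<Sum>t' \<in> T.
     cnj (\<Psi> s t) * (F s s' * G t t') * \<Psi> s' t')"

lemma ip_self: "ip S x x = of_real (norm2 S x)"
  unfolding ip_def norm2_def by (simp only: of_real_sum complex_norm_square mult.commute)

lemma cnj_ip: "cnj (ip S x y) = ip S y x"
  by (simp add: ip_def mult.commute)

lemma ip_cong: "(\<And>s. s \<in> S \<Longrightarrow> x s = x' s) \<Longrightarrow> (\<And>s. s \<in> S \<Longrightarrow> y s = y' s) \<Longrightarrow> ip S x y = ip S x' y'"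
  by (simp add: ip_def)

lemma ip_lincomb:
  "ip S x (\<lambda>s. \<alpha> * y s + \<beta> * z s) = \<alpha> * ip S x y + \<beta> * ip S x z"
  "ip S (\<lambda>s. \<alpha> * y s + \<beta> * z s) x = cnj \<alpha> * ip S y x + cnj \<beta> * ip S z x"
  by (simp_all add: ip_def algebra_simps sum.distrib sum_distrib_left)

lemma norm2_nonneg: "0 \<le> norm2 S x"
  by (simp add: norm2_def sum_nonneg)

lemma norm2_eq_0: "finite S \<Longrightarrow> norm2 S x = 0 \<longleftrightarrow> (\<forall>s \<in> S. x s = 0)"
  by (simp add: norm2_def sum_nonneg_eq_0_iff)

lemma steer_lincomb:
  "steer S \<Psi> (\<lambda>s. \<alpha> * x s + \<beta> * y s) = (\<lambda>t. cnj \<alpha> * steer S \<Psi> x t + cnj \<beta> * steer S \<Psi> y t)"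
  by (simp add: steer_def fun_eq_iff algebra_simps sum.distrib sum_distrib_left)

text \<open>The two steering maps are adjoint in the antilinear sense: both sides are the amplitude
  of the product of \<open>a\<close> and \<open>b\<close> in the state.\<close>

lemma ip_steer: "ip T b (steer S \<Psi> a) = ip S a (steer T (\<lambda>t s. \<Psi> s t) b)"
  unfolding ip_def steer_def sum_distrib_left
  by (subst sum.swap) (simp add: mult_ac)

lemma pair_expval_flip: "pair_expval S T \<Psi> F G = pair_expval T S (\<lambda>t s. \<Psi> s t) G F"
proof -
  have "pair_expval S T \<Psi> F G = (\<Sum>t \<in> T. \<Sum>s \<in> S. \<Sum>s' \<in> S. \<Sum>t' \<in> T.
      cnj (\<Psi> s t) * (F s s' * G t t') * \<Psi> s' t')"
    unfolding pair_expval_def by (rule sum.swap)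
  also have "\<dots> = (\<Sum>t \<in> T. \<Sum>s \<in> S. \<Sum>t' \<in> T. \<Sum>s' \<in> S.
      cnj (\<Psi> s t) * (F s s' * G t t') * \<Psi> s' t')"
    by (intro sum.cong refl) (rule sum.swap)
  finally show ?thesis by (simp add: pair_expval_def mult_ac)
qed

lemma pair_expval_proj_proj:
  "pair_expval S T \<Psi> (proj_on S a) (proj_on T b) =
    of_real ((cmod (ip T b (steer S \<Psi> a)))\<^sup>2 / (norm2 S a * norm2 T b))"
proof -
  define z where "z = ip T b (steer S \<Psi> a)"
  have z: "z = (\<Sum>s \<in> S. \<Sum>t \<in> T. cnj (a s) * cnj (b t) * \<Psi> s t)"
    unfolding z_def ip_def steer_def sum_distrib_left
    by (subst sum.swap) (simp add: mult_ac)
  have "pair_expval S T \<Psi> (proj_on S a) (proj_on T b) =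
      (\<Sum>s \<in> S. \<Sum>t \<in> T. \<Sum>s' \<in> S. \<Sum>t' \<in> T. cnj (cnj (a s) * cnj (b t) * \<Psi> s t) *
        (cnj (a s') * cnj (b t') * \<Psi> s' t') / of_real (norm2 S a * norm2 T b))"
    unfolding pair_expval_def proj_on_def norm2_def
    by (intro sum.cong refl) (simp add: mult_ac)
  also have "\<dots> = cnj z * z / of_real (norm2 S a * norm2 T b)"
    unfolding z cnj_sum sum_divide_distrib[symmetric] sum_distrib_left[symmetric]
      sum_distrib_right[symmetric] ..
  also have "cnj z * z = of_real ((cmod z)\<^sup>2)"
    by (simp only: complex_norm_square mult.commute)
  finally show ?thesis by (simp add: z_def)
qed

lemma pair_expval_proj_id:
  assumes "finite S" "finite T"
  shows "pair_expval S T \<Psi> (proj_on S a) id_op = of_real (norm2 T (steer S \<Psi> a) / norm2 S a)"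
proof -
  have "pair_expval S T \<Psi> (proj_on S a) id_op =
      (\<Sum>s \<in> S. \<Sum>t \<in> T. \<Sum>s' \<in> S. \<Sum>t' \<in> T. if t = t' then
        a s * cnj (\<Psi> s t') * (cnj (a s') * \<Psi> s' t') / of_real (norm2 S a) else 0)"
    unfolding pair_expval_def proj_on_def norm2_def id_op_def
    by (intro sum.cong refl) (simp add: mult_ac)
  also have "\<dots> = (\<Sum>s \<in> S. \<Sum>t \<in> T. \<Sum>s' \<in> S.
        a s * cnj (\<Psi> s t) * (cnj (a s') * \<Psi> s' t) / of_real (norm2 S a))"
    using assms by simp
  also have "\<dots> = (\<Sum>t \<in> T. \<Sum>s \<in> S. \<Sum>s' \<in> S.
        a s * cnj (\<Psi> s t) * (cnj (a s') * \<Psi> s' t) / of_real (norm2 S a))"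
    by (rule sum.swap)
  also have "\<dots> = (\<Sum>t \<in> T. cnj (steer S \<Psi> a t) * steer S \<Psi> a t / of_real (norm2 S a))"
    unfolding sum_divide_distrib[symmetric] sum_distrib_left[symmetric] sum_distrib_right[symmetric]
    by (simp add: steer_def)
  also have "\<dots> = of_real (norm2 T (steer S \<Psi> a) / norm2 S a)"
    using ip_self[of T "steer S \<Psi> a"] by (simp add: ip_def flip: sum_divide_distrib)
  finally show ?thesis .
qed

definition pair_chain ::
  "'s set \<Rightarrow> 't set \<Rightarrow> ('s \<Rightarrow> 't \<Rightarrow> complex) \<Rightarrow> (nat \<Rightarrow> 's cop) \<Rightarrow> (nat \<Rightarrow> 't cop) \<Rightarrow> nat \<Rightarrow> real" where
  "pair_chain S T \<Psi> F G N = chain_error N (\<lambda>\<alpha> \<beta> m m'. Re (pair_expval S T \<Psi>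
     (if \<alpha> = 0 then F m else diff_op id_op (F m)) (if \<beta> = 0 then G m' else diff_op id_op (G m'))))"

lemma pair_expval_diff_op:
  "pair_expval S T \<Psi> F (diff_op G G') = pair_expval S T \<Psi> F G - pair_expval S T \<Psi> F G'"
  "pair_expval S T \<Psi> (diff_op F F') G = pair_expval S T \<Psi> F G - pair_expval S T \<Psi> F' G"
  by (simp_all add: pair_expval_def diff_op_def algebra_simps sum_subtractf)

text \<open>A link error is a marginal success probability minus a joint one. The marginal is the
  squared norm of the steered vector divided by that of the vector projected on.\<close>

lemma pair_chain_proj_on:
  fixes \<Psi> :: "'s \<Rightarrow> 't \<Rightarrow> complex" and a :: "nat \<Rightarrow> 's cvec" and b :: "nat \<Rightarrow> 't cvec"
  assumes "finite S" "finite T"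
  defines "p \<equiv> \<lambda>m m'. (cmod (ip T (b m') (steer S \<Psi> (a m))))\<^sup>2 / (norm2 S (a m) * norm2 T (b m'))"
  shows "pair_chain S T \<Psi> (\<lambda>m. proj_on S (a m)) (\<lambda>m. proj_on T (b m)) N =
    (\<Sum>m<N. (norm2 T (steer S \<Psi> (a m)) / norm2 S (a m) - p m (Suc m)) +
       (norm2 S (steer T (\<lambda>t s. \<Psi> s t) (b m)) / norm2 T (b m) - p (Suc m) m)) + p N N"
  using assms(1,2)
  by (simp add: pair_chain_def chain_error_def pair_expval_diff_op pair_expval_proj_proj
      pair_expval_proj_id pair_expval_flip[of S T \<Psi> id_op] p_def)

text \<open>Hardy's paradox: each party's first vector is steered to the other party's second vector,
  which makes both link errors vanish, so that only the amplitude of the two second vectors has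
  to be killed.\<close>

lemma hardy_chain:
  fixes \<Psi> :: "'s \<Rightarrow> 't \<Rightarrow> complex"
  defines "\<Phi> \<equiv> \<lambda>t s. \<Psi> s t"
  assumes fin: "finite S" "finite T" and c: "c = steer S \<Psi> a0" "\<exists>t \<in> T. c t \<noteq> 0"
    and no_eigen: "\<nexists>\<kappa>. \<forall>t \<in> T. steer S \<Psi> (steer T \<Phi> c) t = \<kappa> * c t"
  shows "\<exists>a b. 0 < Re (pair_expval S T \<Psi> (proj_on S (a 0)) (proj_on T (b 0))) \<and>
    pair_chain S T \<Psi> (\<lambda>m. proj_on S (a m)) (\<lambda>m. proj_on T (b m)) 1 = 0"
proof -
  define d where "d = steer S \<Psi> (steer T \<Phi> c)"
  define \<gamma> where "\<gamma> = ip T d c / ip T d d"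
  \<comment> \<open>\<open>b0\<close> is the component of \<open>c\<close> orthogonal to
    \<open>d\<close>, the image of \<open>c\<close> under both steerings. It is nonzero because
    \<open>c\<close> is not an eigenvector.\<close>
  define b0 where "b0 = (\<lambda>t. 1 * c t + (- \<gamma>) * d t)"
  define a1 where "a1 = steer T \<Phi> b0"
  \<comment> \<open>This is \<open>no_eigen\<close> for \<open>\<kappa> = 0\<close>.\<close>
  have d: "ip T d d \<noteq> 0"
    using no_eigen norm2_eq_0[OF fin(2), of d] unfolding ip_self d_def
    by (metis mult_zero_left of_real_eq_0_iff)
  have db: "ip T d b0 = 0"
    unfolding b0_def ip_lincomb using d by (simp add: \<gamma>_def)
  then have bd: "ip T b0 d = 0" using cnj_ip[of T d b0] by simp
  have bc: "ip T b0 c = ip T b0 b0"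
  proof -
    have "ip T b0 b0 = 1 * ip T b0 c + (- \<gamma>) * ip T b0 d"
      by (subst (2) b0_def) (rule ip_lincomb)
    then show ?thesis using bd by simp
  qed
  have b0: "norm2 T b0 \<noteq> 0"
  proof
    assume "norm2 T b0 = 0"
    then have e: "\<forall>t \<in> T. c t = \<gamma> * d t"
      using norm2_eq_0[OF fin(2)] by (auto simp: b0_def)
    with c(2) have "\<gamma> \<noteq> 0" by auto
    with e have "\<forall>t \<in> T. d t = inverse \<gamma> * c t" by simp
    with no_eigen show False by (auto simp: d_def)
  qed
  have amp00: "ip T b0 c \<noteq> 0" using b0 by (simp add: bc ip_self)
  have adj: "ip T x (steer S \<Psi> y) = ip S y (steer T \<Phi> x)" for x y
    unfolding \<Phi>_def by (rule ip_steer)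
  have c0: "norm2 T c \<noteq> 0" using c(2) norm2_eq_0[OF fin(2)] by auto
  have a0: "norm2 S a0 \<noteq> 0"
  proof
    assume "norm2 S a0 = 0"
    then have "ip S a0 y = 0" for y using norm2_eq_0[OF fin(1)] by (auto simp: ip_def)
    with amp00 show False by (simp add: c(1) adj)
  qed
  have a1: "norm2 S a1 \<noteq> 0"
  proof
    assume "norm2 S a1 = 0"
    then have "ip S a0 a1 = 0" using norm2_eq_0[OF fin(1)] by (auto simp: ip_def)
    with amp00 show False by (simp add: c(1) adj a1_def)
  qed
  \<comment> \<open>Moving both steerings across the inner product turns orthogonality of
    \<open>b0\<close> and \<open>d\<close> into vanishing of the amplitude of the two second
    vectors.\<close>
  have amp11: "ip T c (steer S \<Psi> a1) = 0"
  proof -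
    have "ip T b0 d = ip S (steer T \<Phi> c) a1" by (simp add: d_def adj a1_def)
    then have "ip S a1 (steer T \<Phi> c) = 0" using bd cnj_ip[of S a1] by (metis complex_cnj_zero_iff)
    then show ?thesis by (simp add: adj)
  qed
  define a where "a = (\<lambda>m :: nat. if m = 0 then a0 else a1)"
  define b where "b = (\<lambda>m :: nat. if m = 0 then b0 else c)"
  have "0 < Re (pair_expval S T \<Psi> (proj_on S (a 0)) (proj_on T (b 0)))"
    using amp00 a0 b0 norm2_nonneg[of S a0] norm2_nonneg[of T b0]
    by (simp add: pair_expval_proj_proj a_def b_def c(1)[symmetric] less_le)
  moreover have "pair_chain S T \<Psi> (\<lambda>m. proj_on S (a m)) (\<lambda>m. proj_on T (b m)) 1 = 0"
  proof -
    have "ip T b0 (steer S \<Psi> a1) = of_real (norm2 S a1)"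
      by (simp add: adj a1_def[symmetric] ip_self)
    then show ?thesis
      unfolding pair_chain_proj_on[OF fin]
      using c0 a1 by (simp add: a_def b_def c(1)[symmetric] amp11 ip_self a1_def[symmetric]
          \<Phi>_def[symmetric] power2_eq_square)
  qed
  ultimately show ?thesis by blast
qed

text \<open>Gram-Schmidt, stated through coefficients so that linearity carries eigenvalue equations
  from \<open>c0\<close> and \<open>c1\<close> to the orthonormal pair.\<close>

lemma orthonormal_pair:
  assumes fin: "finite T" and c0: "\<exists>t \<in> T. c0 t \<noteq> 0" and indep: "\<nexists>\<kappa>. \<forall>t \<in> T. c1 t = \<kappa> * c0 t"
  obtains \<alpha> \<beta> \<gamma> where
    "ip T (\<lambda>t. \<alpha> * c0 t) (\<lambda>t. \<alpha> * c0 t) = 1"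
    "ip T (\<lambda>t. \<beta> * c0 t + \<gamma> * c1 t) (\<lambda>t. \<beta> * c0 t + \<gamma> * c1 t) = 1"
    "ip T (\<lambda>t. \<alpha> * c0 t) (\<lambda>t. \<beta> * c0 t + \<gamma> * c1 t) = 0"
proof -
  define \<mu> where "\<mu> = ip T c0 c1 / ip T c0 c0"
  define d where "d = (\<lambda>t. (- \<mu>) * c0 t + 1 * c1 t)"
  have n0: "0 < norm2 T c0"
    using c0 norm2_eq_0[OF fin, of c0] norm2_nonneg[of T c0] by (auto simp: less_le)
  have "norm2 T d \<noteq> 0"
  proof
    assume "norm2 T d = 0"
    then have "\<forall>t \<in> T. c1 t = \<mu> * c0 t" using norm2_eq_0[OF fin] by (auto simp: d_def)
    with indep show False by blast
  qed
  then have nd: "0 < norm2 T d" using norm2_nonneg[of T d] by simp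
  have orth: "ip T c0 d = 0"
    unfolding d_def ip_lincomb using n0 by (simp add: \<mu>_def ip_self)
  have scale: "ip T (\<lambda>t. of_real r * x t) (\<lambda>t. of_real s * y t) = of_real (r * s) * ip T x y"
    for r s :: real and x y
    by (simp add: ip_def sum_distrib_left mult_ac)
  define r where "r = inverse (sqrt (norm2 T c0))"
  define s where "s = inverse (sqrt (norm2 T d))"
  have r: "r * r * norm2 T c0 = 1" and s: "s * s * norm2 T d = 1"
    using n0 nd by (simp_all add: r_def s_def field_simps)
  have d': "(\<lambda>t. (- of_real s * \<mu>) * c0 t + of_real s * c1 t) = (\<lambda>t. of_real s * d t)"
    by (simp add: d_def fun_eq_iff algebra_simps)
  show thesis
  proof (rule that[of "of_real r" "- of_real s * \<mu>" "of_real s"])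
    show "ip T (\<lambda>t. of_real r * c0 t) (\<lambda>t. of_real r * c0 t) = 1"
      unfolding scale unfolding ip_self of_real_mult[symmetric] r by simp
    show "ip T (\<lambda>t. (- of_real s * \<mu>) * c0 t + of_real s * c1 t)
        (\<lambda>t. (- of_real s * \<mu>) * c0 t + of_real s * c1 t) = 1"
      unfolding d' scale unfolding ip_self of_real_mult[symmetric] s by simp
    show "ip T (\<lambda>t. of_real r * c0 t) (\<lambda>t. (- of_real s * \<mu>) * c0 t + of_real s * c1 t) = 0"
      unfolding d' scale orth by simp
  qed
qed

text \<open>On the plane spanned by \<open>f0\<close> and \<open>f1\<close> the state acts like a maximally entangled pair of
  qubits. Consecutive vectors of the chain differ by the angle \<open>\<pi> / (4 * N)\<close>; the \<open>2 * N\<close> links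
  together turn \<open>0\<close> into the right angle of the last pair.\<close>

lemma rotating_chain:
  fixes \<Psi> :: "'s \<Rightarrow> 't \<Rightarrow> complex"
  defines "\<Phi> \<equiv> \<lambda>t s. \<Psi> s t"
  assumes fin: "finite S" "finite T"
    and eigen: "\<And>t. t \<in> T \<Longrightarrow> steer S \<Psi> (steer T \<Phi> f0) t = of_real \<mu> * f0 t"
      "\<And>t. t \<in> T \<Longrightarrow> steer S \<Psi> (steer T \<Phi> f1) t = of_real \<mu> * f1 t"
    and \<mu>: "0 < \<mu>"
    and orthonormal: "ip T f0 f0 = 1" "ip T f1 f1 = 1" "ip T f0 f1 = 0"
    and "0 < \<delta>"
  shows "\<exists>N a b. Re (pair_expval S T \<Psi> (proj_on S (a 0)) (proj_on T (b 0))) = \<mu> \<and>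
    pair_chain S T \<Psi> (\<lambda>m. proj_on S (a m)) (\<lambda>m. proj_on T (b m)) N \<le> \<delta>"
proof -
  define v where "v \<theta> = (\<lambda>t. of_real (cos \<theta>) * f0 t + of_real (sin \<theta>) * f1 t)" for \<theta>
  \<comment> \<open>Steering \<open>u \<theta>\<close> back gives \<open>\<mu>\<close> times
    \<open>v \<theta>\<close>, so amplitudes depend only on the difference of angles.\<close>
  define u where "u \<theta> = steer T \<Phi> (v \<theta>)" for \<theta>
  have Ju: "steer S \<Psi> (u \<theta>) t = of_real \<mu> * v \<theta> t" if "t \<in> T" for \<theta> t
    unfolding u_def v_def steer_lincomb using eigen that by (simp add: algebra_simps)
  have "ip T f1 f0 = 0" using orthonormal(3) cnj_ip[of T f0 f1] by simp
  then have vv: "ip T (v \<phi>) (v \<theta>) = of_real (cos (\<theta> - \<phi>))" for \<theta> \<phi>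
    unfolding v_def ip_lincomb using orthonormal by (simp add: cos_diff mult.commute)
  have nv: "norm2 T (v \<theta>) = 1" for \<theta>
    using vv[of \<theta> \<theta>] by (simp add: ip_self)
  have amp: "ip T (v \<phi>) (steer S \<Psi> (u \<theta>)) = of_real (\<mu> * cos (\<theta> - \<phi>))" for \<theta> \<phi>
  proof -
    have "ip T (v \<phi>) (steer S \<Psi> (u \<theta>)) = ip T (v \<phi>) (\<lambda>t. of_real \<mu> * v \<theta> t + 0 * v \<theta> t)"
      by (rule ip_cong) (simp_all add: Ju)
    also have "\<dots> = of_real \<mu> * ip T (v \<phi>) (v \<theta>)" unfolding ip_lincomb by simp
    finally show ?thesis by (simp add: vv)
  qed
  have nu: "norm2 S (u \<theta>) = \<mu>" for \<theta>
  proof -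
    have "complex_of_real (norm2 S (u \<theta>)) = of_real \<mu>"
      using amp[of \<theta> \<theta>] ip_steer[of T "v \<theta>" S \<Psi> "u \<theta>"]
      by (simp add: ip_self[symmetric] u_def \<Phi>_def)
    then show ?thesis by (simp only: of_real_eq_iff)
  qed
  have nJu: "norm2 T (steer S \<Psi> (u \<theta>)) = \<mu>\<^sup>2" for \<theta>
  proof -
    have "norm2 T (steer S \<Psi> (u \<theta>)) = \<mu>\<^sup>2 * norm2 T (v \<theta>)"
      unfolding norm2_def sum_distrib_left
      by (rule sum.cong) (simp_all add: Ju norm_mult power_mult_distrib)
    then show ?thesis by (simp add: nv)
  qed
  define N where "N = Suc (nat \<lceil>2 * \<mu> / \<delta>\<rceil>)"
  have N: "0 < real N" "2 * \<mu> / real N \<le> \<delta>"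
  proof -
    show "0 < real N" by (simp add: N_def)
    have "2 * \<mu> / \<delta> \<le> real N" unfolding N_def by linarith
    then show "2 * \<mu> / real N \<le> \<delta>"
      using \<open>0 < \<delta>\<close> \<open>0 < real N\<close> by (simp add: field_simps)
  qed
  define \<eta> where "\<eta> = pi / (4 * real N)"
  \<comment> \<open>With \<open>a m\<close> at angle \<open>ang m\<close> and \<open>b m\<close> at
    \<open>- ang m\<close>, the sequences \<open>a 0\<close>, \<open>b 1\<close>,
    \<open>a 2\<close>, ... and \<open>b 0\<close>, \<open>a 1\<close>, \<open>b 2\<close>, ...
    rotate in opposite directions by \<open>\<eta>\<close> per link. After \<open>N\<close> links
    each has turned by \<open>pi / 4\<close>, so the last pair is at a right angle.\<close>
  define ang where "ang m = (- 1) ^ m * real m * \<eta>" for m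
  define a where "a m = u (ang m)" for m
  define b where "b m = v (- ang m)" for m
  define p where "p m m' = (cmod (ip T (b m') (steer S \<Psi> (a m))))\<^sup>2 / (norm2 S (a m) * norm2 T (b m'))" for m m'
  have p: "p m m' = \<mu> * (cos (ang m + ang m'))\<^sup>2" for m m'
  proof -
    have "(cmod (ip T (b m') (steer S \<Psi> (a m))))\<^sup>2 = (\<mu> * cos (ang m + ang m'))\<^sup>2"
      unfolding a_def b_def amp norm_of_real by simp
    then show ?thesis
      using \<mu> unfolding p_def a_def b_def nv nu by (simp add: power2_eq_square)
  qed
  have link: "(cos (ang m + ang (Suc m)))\<^sup>2 = 1 - (sin \<eta>)\<^sup>2" for m
  proof -
    have "ang m + ang (Suc m) = - ((- 1) ^ m * \<eta>)" by (simp add: ang_def algebra_simps)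
    then have "cos (ang m + ang (Suc m)) = cos \<eta>" by (cases "even m") auto
    then show ?thesis by (simp add: cos_squared_eq)
  qed
  have last: "cos (ang N + ang N) = 0"
  proof -
    have "ang N + ang N = (- 1) ^ N * (pi / 2)" using N(1) by (simp add: ang_def \<eta>_def field_simps)
    then show ?thesis by (simp only:) (cases "even N"; simp)
  qed
  have "Re (pair_expval S T \<Psi> (proj_on S (a 0)) (proj_on T (b 0))) = p 0 0"
    by (simp add: pair_expval_proj_proj p_def)
  also have "\<dots> = \<mu>" by (simp add: p ang_def)
  finally have succ: "Re (pair_expval S T \<Psi> (proj_on S (a 0)) (proj_on T (b 0))) = \<mu>" .
  have pl: "p m (Suc m) = \<mu> * (1 - (sin \<eta>)\<^sup>2)" "p (Suc m) m = \<mu> * (1 - (sin \<eta>)\<^sup>2)" "p N N = 0" for m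
    unfolding p last add.commute[of "ang (Suc m)" "ang m"] link by simp_all
  have marg: "norm2 T (steer S \<Psi> (a m)) / norm2 S (a m) = \<mu>"
    "norm2 S (steer T (\<lambda>t s. \<Psi> s t) (b m)) / norm2 T (b m) = \<mu>" for m
    using \<mu> by (simp_all add: a_def nJu nu b_def nv power2_eq_square flip: \<Phi>_def u_def)
  have "pair_chain S T \<Psi> (\<lambda>m. proj_on S (a m)) (\<lambda>m. proj_on T (b m)) N =
      (\<Sum>m<N. (\<mu> - p m (Suc m)) + (\<mu> - p (Suc m) m)) + p N N"
    unfolding pair_chain_proj_on[OF fin] p_def[symmetric] marg ..
  also have "\<dots> = real N * (2 * \<mu> * (sin \<eta>)\<^sup>2)"
    unfolding pl by (simp add: algebra_simps)
  \<comment> \<open>The error per link is quadratic in \<open>\<eta>\<close>, of order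
    \<open>1 / N\<^sup>2\<close>, so \<open>2 * N\<close> links cost only order
    \<open>1 / N\<close>.\<close>
  also have "\<dots> \<le> real N * (2 * \<mu> * \<eta>\<^sup>2)"
    using \<mu> abs_sin_x_le_abs_x[of \<eta>] by (intro mult_left_mono) (auto simp: abs_le_square_iff)
  also have "\<dots> = 2 * \<mu> / real N * (pi / 4)\<^sup>2"
    using N(1) by (simp add: \<eta>_def power2_eq_square field_simps)
  also have "\<dots> \<le> 2 * \<mu> / real N"
    using \<mu> N(1) pi_less_4 by (intro mult_left_le power_le_one) auto
  also have "\<dots> \<le> \<delta>" by (rule N)
  finally show ?thesis using succ by blast
qed

text \<open>The order of quantifiers matters: \<open>h\<close> is fixed before
  \<open>\<delta>\<close>, so the error can later be made small relative to the product of the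
  values \<open>h\<close> of all edges.\<close>

lemma entangled_chain:
  fixes \<Psi> :: "'s \<Rightarrow> 't \<Rightarrow> complex"
  assumes fin: "finite S" "finite T"
    and entangled: "\<nexists>u w. \<forall>s \<in> S. \<forall>t \<in> T. \<Psi> s t = u s * w t"
  shows "\<exists>h > 0. \<forall>\<delta> > 0. \<exists>N a b.
    h \<le> Re (pair_expval S T \<Psi> (proj_on S (a 0)) (proj_on T (b 0))) \<and>
    pair_chain S T \<Psi> (\<lambda>m. proj_on S (a m)) (\<lambda>m. proj_on T (b m)) N \<le> \<delta>"
proof -
  define \<Phi> where "\<Phi> = (\<lambda>t s. \<Psi> s t)"
  define K where "K x = steer S \<Psi> (steer T \<Phi> x)" for x
  have K_lincomb: "K (\<lambda>t. \<alpha> * x t + \<beta> * y t) = (\<lambda>t. \<alpha> * K x t + \<beta> * K y t)" for \<alpha> \<beta> x y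
    by (simp add: K_def steer_lincomb)
  show ?thesis
  proof (cases "\<exists>a0. (\<exists>t \<in> T. steer S \<Psi> a0 t \<noteq> 0) \<and>
      (\<nexists>\<kappa>. \<forall>t \<in> T. K (steer S \<Psi> a0) t = \<kappa> * steer S \<Psi> a0 t)")
    case True
    then obtain a b where
      "0 < Re (pair_expval S T \<Psi> (proj_on S (a 0)) (proj_on T (b 0)))"
      "pair_chain S T \<Psi> (\<lambda>m. proj_on S (a m)) (\<lambda>m. proj_on T (b m)) 1 = 0"
      using hardy_chain[OF fin refl] unfolding K_def \<Phi>_def by blast
    \<comment> \<open>The Hardy chain has zero error, so the same chain serves every
      \<open>\<delta>\<close>.\<close>
    then show ?thesis by (metis less_imp_le order_refl)
  next
    case False
    then have eigen: "\<exists>\<kappa>. \<forall>t \<in> T. K (steer S \<Psi> a) t = \<kappa> * steer S \<Psi> a t"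
      if "\<exists>t \<in> T. steer S \<Psi> a t \<noteq> 0" for a using that by blast
    have "\<exists>s0 \<in> S. \<exists>t \<in> T. \<Psi> s0 t \<noteq> 0"
    proof (rule ccontr)
      assume "\<not> ?thesis"
      then have "\<exists>u w. \<forall>s \<in> S. \<forall>t \<in> T. \<Psi> s t = u s * w t"
        by (intro exI[of _ "\<lambda>_. 0"]) simp
      with entangled show False by blast
    qed
    then obtain s0 where s0: "s0 \<in> S" "\<exists>t \<in> T. \<Psi> s0 t \<noteq> 0" by blast
    \<comment> \<open>If all rows were multiples of row \<open>s0\<close>, the state would be a
      product. Two independent rows span the plane for the rotation.\<close>
    have "\<exists>s1 \<in> S. \<nexists>\<kappa>. \<forall>t \<in> T. \<Psi> s1 t = \<kappa> * \<Psi> s0 t"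
    proof (rule ccontr)
      assume "\<not> ?thesis"
      then obtain u where "\<forall>s \<in> S. \<forall>t \<in> T. \<Psi> s t = u s * \<Psi> s0 t" by metis
      with entangled show False by blast
    qed
    then obtain s1 where s1: "s1 \<in> S" "\<nexists>\<kappa>. \<forall>t \<in> T. \<Psi> s1 t = \<kappa> * \<Psi> s0 t" by blast
    define e where "e s = (\<lambda>s'. if s' = s then 1 else 0 :: complex)" for s :: 's
    have Je: "steer S \<Psi> (e s) t = \<Psi> s t" if "s \<in> S" for s t
    proof -
      have "steer S \<Psi> (e s) t = (\<Sum>s' \<in> S. if s' = s then \<Psi> s' t else 0)"
        unfolding steer_def e_def by (rule sum.cong) auto
      then show ?thesis using fin(1) that by simp
    qed
    define c0 where "c0 = steer S \<Psi> (e s0)"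
    define c1 where "c1 = steer S \<Psi> (e s1)"
    have c0: "\<exists>t \<in> T. c0 t \<noteq> 0" and indep: "\<nexists>\<kappa>. \<forall>t \<in> T. c1 t = \<kappa> * c0 t"
      using s0 s1 by (simp_all add: c0_def c1_def Je)
    \<comment> \<open>The sum of \<open>c0\<close> and \<open>c1\<close> is also steered to, hence
      also an eigenvector; with linear independence this forces a common eigenvalue. The factors 1
      match \<open>steer_lincomb\<close>.\<close>
    have sum: "steer S \<Psi> (\<lambda>s. 1 * e s0 s + 1 * e s1 s) = (\<lambda>t. 1 * c0 t + 1 * c1 t)"
      unfolding steer_lincomb c0_def c1_def by simp
    obtain \<mu>0 where \<mu>0: "\<forall>t \<in> T. K c0 t = \<mu>0 * c0 t"
      using eigen[of "e s0"] c0 unfolding c0_def by blast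
    have "\<exists>t \<in> T. c1 t \<noteq> 0" using indep by (metis mult_zero_left)
    then obtain \<mu>1 where \<mu>1: "\<forall>t \<in> T. K c1 t = \<mu>1 * c1 t"
      using eigen[of "e s1"] unfolding c1_def by blast
    have "\<exists>t \<in> T. 1 * c0 t + 1 * c1 t \<noteq> 0"
      using indep by (metis add_eq_0_iff mult_1 mult_minus_left)
    then obtain \<mu>2 where \<mu>2: "\<forall>t \<in> T. K (\<lambda>t. 1 * c0 t + 1 * c1 t) t = \<mu>2 * (1 * c0 t + 1 * c1 t)"
      using eigen[of "\<lambda>s. 1 * e s0 s + 1 * e s1 s"] unfolding sum by blast
    have rel: "(\<mu>1 - \<mu>2) * c1 t = (\<mu>2 - \<mu>0) * c0 t" if "t \<in> T" for t
    proof -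
      have "\<mu>0 * c0 t + \<mu>1 * c1 t = \<mu>2 * (c0 t + c1 t)"
        using \<mu>2[rule_format, OF that] \<mu>0 \<mu>1 that unfolding K_lincomb by simp
      then show ?thesis by algebra
    qed
    have "\<mu>1 = \<mu>2"
    proof (rule ccontr)
      assume "\<mu>1 \<noteq> \<mu>2"
      then have "\<forall>t \<in> T. c1 t = ((\<mu>2 - \<mu>0) / (\<mu>1 - \<mu>2)) * c0 t"
        using rel by (simp add: field_simps)
      with indep show False by blast
    qed
    with rel c0 have \<mu>01: "\<mu>1 = \<mu>0" by auto
    have adj: "ip T x (steer S \<Psi> y) = ip S y (steer T \<Phi> x)" for x y
      unfolding \<Phi>_def by (rule ip_steer)
    have n0: "norm2 T c0 \<noteq> 0" using c0 norm2_eq_0[OF fin(2)] by auto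
    \<comment> \<open>By adjointness the eigenvalue is this quotient of squared norms, hence real;
      it is positive because \<open>steer T \<Phi> c0\<close> has nonzero inner product with
      \<open>e s0\<close>.\<close>
    define m where "m = norm2 S (steer T \<Phi> c0) / norm2 T c0"
    have "\<mu>0 * norm2 T c0 = norm2 S (steer T \<Phi> c0)"
    proof -
      have "ip T c0 (K c0) = ip T c0 (\<lambda>t. \<mu>0 * c0 t + 0 * c0 t)"
        by (rule ip_cong) (simp_all add: \<mu>0)
      then show ?thesis unfolding ip_lincomb by (simp add: K_def adj ip_self)
    qed
    then have m: "\<mu>0 = of_real m" using n0 by (simp add: m_def field_simps)
    have "norm2 S (steer T \<Phi> c0) \<noteq> 0"
    proof
      assume "norm2 S (steer T \<Phi> c0) = 0"
      then have "ip S (e s0) (steer T \<Phi> c0) = 0"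
        using norm2_eq_0[OF fin(1)] by (auto simp: ip_def)
      then have "ip T c0 c0 = 0" by (simp add: adj[symmetric] c0_def[symmetric])
      with n0 show False by (simp add: ip_self)
    qed
    then have m_pos: "0 < m"
      unfolding m_def using n0 norm2_nonneg[of T c0] norm2_nonneg[of S "steer T \<Phi> c0"]
      by (simp add: less_le)
    obtain \<alpha> \<beta> \<gamma> where on:
      "ip T (\<lambda>t. \<alpha> * c0 t) (\<lambda>t. \<alpha> * c0 t) = 1"
      "ip T (\<lambda>t. \<beta> * c0 t + \<gamma> * c1 t) (\<lambda>t. \<beta> * c0 t + \<gamma> * c1 t) = 1"
      "ip T (\<lambda>t. \<alpha> * c0 t) (\<lambda>t. \<beta> * c0 t + \<gamma> * c1 t) = 0"
      by (rule orthonormal_pair[OF fin(2) c0 indep])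
    have "K (\<lambda>t. \<alpha> * c0 t + 0 * c0 t) t = of_real m * (\<alpha> * c0 t)" if "t \<in> T" for t
      unfolding K_lincomb using \<mu>0 that by (simp add: m)
    then have eig0: "K (\<lambda>t. \<alpha> * c0 t) t = of_real m * (\<alpha> * c0 t)" if "t \<in> T" for t
      using that by simp
    have eig1: "K (\<lambda>t. \<beta> * c0 t + \<gamma> * c1 t) t = of_real m * (\<beta> * c0 t + \<gamma> * c1 t)" if "t \<in> T" for t
      unfolding K_lincomb using \<mu>0 \<mu>1 that by (simp add: m \<mu>01 algebra_simps)
    have "\<exists>N a b. Re (pair_expval S T \<Psi> (proj_on S (a 0)) (proj_on T (b 0))) = m \<and>
        pair_chain S T \<Psi> (\<lambda>m. proj_on S (a m)) (\<lambda>m. proj_on T (b m)) N \<le> \<delta>" if "0 < \<delta>" for \<delta>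
      by (rule rotating_chain[OF fin eig0[unfolded K_def \<Phi>_def] eig1[unfolded K_def \<Phi>_def] m_pos on that])
    then show ?thesis using m_pos by (metis order_refl)
  qed
qed

section \<open>Networks of entangled pairs\<close>

definition pair_vec :: "'p \<Rightarrow> 'p \<Rightarrow> 'b \<Rightarrow> 'b \<Rightarrow> 'p \<Rightarrow> 'b" where
  "pair_vec i j s t = (\<lambda>k \<in> {i, j}. if k = i then s else t)"

lemma sum_PiE_pair:
  assumes "i \<noteq> j"
  shows "(\<Sum>y \<in> Pi\<^sub>E {i, j} H. f y) = (\<Sum>s \<in> H i. \<Sum>t \<in> H j. f (pair_vec i j s t))"
proof -
  have "(\<Sum>y \<in> Pi\<^sub>E {i, j} H. f y) = (\<Sum>(s, t) \<in> H i \<times> H j. f (pair_vec i j s t))"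
  proof (rule sum.reindex_bij_witness[of _ "\<lambda>(s, t). pair_vec i j s t" "\<lambda>y. (y i, y j)"], goal_cases)
    case (1 y)
    then show ?case using assms PiE_arb[OF 1] by (auto simp: pair_vec_def fun_eq_iff restrict_def)
  next
    case (5 y)
    have "pair_vec i j (y i) (y j) = y"
      using assms PiE_arb[OF 5] by (auto simp: pair_vec_def fun_eq_iff restrict_def)
    then show ?case by simp
  qed (use assms in \<open>auto simp: pair_vec_def split: if_splits\<close>)
  then show ?thesis by (simp add: sum.cartesian_product)
qed

lemma expval_pair:
  assumes "i \<noteq> j"
  shows "expval (Pi\<^sub>E {i, j} H) (tensor_op {i, j} F) v =
    pair_expval (H i) (H j) (\<lambda>s t. v (pair_vec i j s t)) (F i) (F j)"
  unfolding expval_def pair_expval_def sum_PiE_pair[OF assms]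
  using assms by (simp add: tensor_op_def pair_vec_def)

lemma pure_entangled_pair:
  assumes "i \<noteq> j" "pure_entangled {i, j} H v"
  shows "\<nexists>u w. \<forall>s \<in> H i. \<forall>t \<in> H j. v (pair_vec i j s t) = u s * w t"
proof
  assume "\<exists>u w. \<forall>s \<in> H i. \<forall>t \<in> H j. v (pair_vec i j s t) = u s * w t"
  then obtain u w where uw: "\<And>s t. s \<in> H i \<Longrightarrow> t \<in> H j \<Longrightarrow> v (pair_vec i j s t) = u s * w t"
    by blast
  have "v y = (\<Prod>k \<in> {i, j}. (if k = i then u else w) (y k))" if y: "y \<in> Pi\<^sub>E {i, j} H" for y
  proof -
    have "pair_vec i j (y i) (y j) = y"
      using assms(1) PiE_arb[OF y] by (auto simp: pair_vec_def fun_eq_iff restrict_def)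
    moreover have "y i \<in> H i" "y j \<in> H j" using y by auto
    ultimately have "v y = u (y i) * w (y j)" using uw by metis
    then show ?thesis using assms(1) by simp
  qed
  then have "product_vector {i, j} H v"
    unfolding product_vector_def by (intro exI[of _ "\<lambda>k. if k = i then u else w"] ballI)
  with assms(2) show False by (simp add: pure_entangled_def)
qed

lemma pair_prob_born:
  assumes "finite V" "i \<in> V" "j \<in> V" "i \<noteq> j" "\<alpha> \<le> 1" "\<beta> \<le> 1"
    and F: "\<And>v \<chi> y z. F v \<chi> 0 y z + F v \<chi> 1 y z = id_op y z"
  shows "pair_prob V (\<lambda>_. {0, 1 :: nat}) i j \<alpha> \<beta> (born_dist V H F (projector \<Phi>)) x =
    Re (expval (Pi\<^sub>E V H) (tensor_op V ((\<lambda>_. id_op)(i := F i (x i) \<alpha>, j := F j (x j) \<beta>))) \<Phi>)"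
proof -
  \<comment> \<open>Indicators at \<open>i\<close> and \<open>j\<close> and weight 1 elsewhere,
    where the two effects sum to the identity.\<close>
  define w :: "'a \<Rightarrow> nat \<Rightarrow> real" where
    "w v \<alpha>' = (if v = i then of_bool (\<alpha>' = \<alpha>) else if v = j then of_bool (\<alpha>' = \<beta>) else 1)" for v \<alpha>'
  have w: "(\<Prod>v \<in> V. w v (a v)) = of_bool (a i = \<alpha> \<and> a j = \<beta>)" for a
  proof -
    have "V = insert i (insert j (V - {i, j}))" using assms(2,3) by auto
    then have "(\<Prod>v \<in> V. w v (a v)) = (\<Prod>v \<in> insert i (insert j (V - {i, j})). w v (a v))" by simp
    also have "\<dots> = w i (a i) * (w j (a j) * (\<Prod>v \<in> V - {i, j}. w v (a v)))"
      using assms(1,4) by (subst prod.insert; simp)+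
    also have "(\<Prod>v \<in> V - {i, j}. w v (a v)) = 1"
      by (rule prod.neutral) (simp add: w_def)
    finally show ?thesis using assms(4) by (simp add: w_def)
  qed
  have "(\<lambda>v y z. \<Sum>\<alpha>' \<in> {0, 1 :: nat}. of_real (w v \<alpha>') * F v (x v) \<alpha>' y z) =
      (\<lambda>_. id_op)(i := F i (x i) \<alpha>, j := F j (x j) \<beta>)"
  proof (intro ext)
    fix v y z
    show "(\<Sum>\<alpha>' \<in> {0, 1 :: nat}. of_real (w v \<alpha>') * F v (x v) \<alpha>' y z) =
        ((\<lambda>_. id_op)(i := F i (x i) \<alpha>, j := F j (x j) \<beta>)) v y z"
      using assms(4-6) F[of v "x v" y z] by (auto simp: w_def le_Suc_eq)
  qed
  then show ?thesis
    unfolding pair_prob_def w[symmetric]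
    by (subst born_dist_marginal[OF assms(1)]) (simp_all only: finite.intros)
qed

text \<open>If only factor \<open>k\<close> is measured, failure of the product effect is failure at
  \<open>k\<close>, which is again a product effect.\<close>

lemma complement_tensor_op:
  assumes "finite N" "k \<in> N" "y \<in> Pi\<^sub>E N H" "z \<in> Pi\<^sub>E N H"
    and id: "\<And>k'. k' \<in> N - {k} \<Longrightarrow> X k' = id_op"
  shows "diff_op id_op (tensor_op N X) y z = tensor_op N (X(k := diff_op id_op (X k))) y z"
proof -
  have "tensor_op N (X(k := id_op)) y z = tensor_op N (\<lambda>_. id_op) y z"
    by (rule tensor_op_cong) (use id in auto)
  also have "\<dots> = id_op y z" by (rule tensor_op_id_op[OF assms(1,3,4)])
  finally show ?thesis
    unfolding tensor_op_diff_op[OF assms(1,2)] by (simp add: diff_op_def)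
qed

text \<open>Each factor of a product effect has expectation at most \<open>1\<close>, so the expectation of the
  product is bounded by the factor of a single edge.\<close>

lemma network_expval_le_edge:
  assumes graph: "finite_graph V E ends"
    and fin: "\<And>k v. k \<in> E \<Longrightarrow> v \<in> ends k \<Longrightarrow> finite (B v k)"
    and unit: "\<And>k. k \<in> E \<Longrightarrow> unit_vector (Pi\<^sub>E (ends k) (\<lambda>v. B v k)) (\<psi> k)"
    and k: "k \<in> E" "ends k = {i, j}" "i \<noteq> j"
    and X: "\<And>k'. k' \<in> E \<Longrightarrow> i \<in> ends k' \<Longrightarrow> is_projection (B i k') (X k')"
    and Y: "\<And>k'. k' \<in> E \<Longrightarrow> j \<in> ends k' \<Longrightarrow> is_projection (B j k') (Y k')"
    and F: "\<And>y z. y \<in> party_space E ends B i \<Longrightarrow> z \<in> party_space E ends B i \<Longrightarrow>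
      F y z = tensor_op (incident_edges E ends i) X y z"
    and G: "\<And>y z. y \<in> party_space E ends B j \<Longrightarrow> z \<in> party_space E ends B j \<Longrightarrow>
      G y z = tensor_op (incident_edges E ends j) Y y z"
  shows "Re (expval (Pi\<^sub>E V (party_space E ends B)) (tensor_op V ((\<lambda>_. id_op)(i := F, j := G)))
      (network_state E ends \<psi>)) \<le>
    Re (pair_expval (B i k) (B j k) (\<lambda>s t. \<psi> k (pair_vec i j s t)) (X k) (Y k))"
proof -
  \<comment> \<open>Edge by edge effects of the whole network: \<open>X\<close> at party
    \<open>i\<close>, \<open>Y\<close> at party \<open>j\<close>, the identity at all
    others.\<close>
  define W where "W = (\<lambda>_ _. id_op)(i := X, j := Y)"
  define val where
    "val k' = expval (Pi\<^sub>E (ends k') (\<lambda>v. B v k')) (tensor_op (ends k') (\<lambda>v. W v k')) (\<psi> k')" for k'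
  have finE: "finite E" and fine: "\<And>k. k \<in> E \<Longrightarrow> finite (ends k)"
    and sub: "ends k \<subseteq> V"
    using graph k(1) by (auto simp: finite_graph_def intro: finite_subset)
  have W: "is_projection (B v k') (W v k')" if "k' \<in> E" "v \<in> ends k'" for v k'
    using X Y fin that by (auto simp: W_def intro!: is_projection_id_op)
  have val: "val k' = of_real (Re (val k'))" "0 \<le> Re (val k')" "Re (val k') \<le> 1" if "k' \<in> E" for k'
    unfolding val_def using W fin fine that unit
    by (intro expval_projection_bounds is_projection_tensor_op finite_PiE; blast)+
  have "expval (Pi\<^sub>E V (party_space E ends B)) (tensor_op V ((\<lambda>_. id_op)(i := F, j := G)))
      (network_state E ends \<psi>) =
    expval (Pi\<^sub>E V (party_space E ends B))
      (tensor_op V (\<lambda>v. tensor_op (incident_edges E ends v) (W v))) (network_state E ends \<psi>)"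
  proof (rule expval_cong[OF tensor_op_cong refl], goal_cases)
    case (1 y z v)
    then have yz: "y v \<in> party_space E ends B v" "z v \<in> party_space E ends B v" by auto
    have "finite (incident_edges E ends v)" using finE by (simp add: incident_edges_def)
    from tensor_op_id_op[OF this yz[unfolded party_space_def]] F G yz
    show ?case using k(3) by (auto simp: W_def)
  qed
  also have "\<dots> = (\<Prod>k' \<in> E. val k')"
    unfolding val_def by (rule network_expval[OF graph fin])
  also have "\<dots> = of_real (\<Prod>k' \<in> E. Re (val k'))"
    unfolding of_real_prod by (rule prod.cong[OF refl val(1)])
  finally have "Re (expval (Pi\<^sub>E V (party_space E ends B)) (tensor_op V ((\<lambda>_. id_op)(i := F, j := G)))
      (network_state E ends \<psi>)) = Re (val k) * (\<Prod>k' \<in> E - {k}. Re (val k'))"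
    by (simp only: Re_complex_of_real prod.remove[OF finE k(1)])
  also have "\<dots> \<le> Re (val k)"
    by (intro mult_left_le prod_le_1) (use val k(1) in auto)
  also have "val k = pair_expval (B i k) (B j k) (\<lambda>s t. \<psi> k (pair_vec i j s t)) (X k) (Y k)"
    unfolding val_def k(2) expval_pair[OF k(3)] using k(3) by (simp add: W_def)
  finally show ?thesis .
qed

theorem theorem1:
  fixes n :: nat
    and E :: "'e set"
    and ends :: "'e \<Rightarrow> nat set"
    and B :: "nat \<Rightarrow> 'e \<Rightarrow> 'b set"
    and \<psi> :: "'e \<Rightarrow> (nat \<Rightarrow> 'b) cvec"
  assumes "n \<ge> 2"
    and "connected_graph {1..n} E ends"
    and "\<And>k i. k \<in> E \<Longrightarrow> i \<in> ends k \<Longrightarrow> finite (B i k)"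
    and "\<And>k. k \<in> E \<Longrightarrow> pure_entangled (ends k) (\<lambda>i. B i k) (\<psi> k)"
  shows "GMNL_state {1..n} (party_space E ends B) (projector (network_state E ends \<psi>))"
proof -
  let ?V = "{1..n}"
  let ?H = "party_space E ends B"
  have graph: "finite_graph ?V E ends" using assms(2) by (simp add: connected_graph_def)
  then have finE: "finite E" by (simp add: finite_graph_def)
  \<comment> \<open>An arbitrary orientation of each edge fixes which end plays the first party of
    its chain.\<close>
  have "\<exists>i j. ends k = {i, j} \<and> i \<noteq> j \<and> {i, j} \<subseteq> ?V" if "k \<in> E" for k
    using graph that unfolding finite_graph_def card_2_iff by metis
  then obtain src dst where
    ends: "\<And>k. k \<in> E \<Longrightarrow> ends k = {src k, dst k} \<and> src k \<noteq> dst k \<and> {src k, dst k} \<subseteq> ?V"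
    by metis
  define S where "S k = B (src k) k" for k
  define T where "T k = B (dst k) k" for k
  define \<Psi> where "\<Psi> k = (\<lambda>s t. \<psi> k (pair_vec (src k) (dst k) s t))" for k
  have fin: "finite (S k)" "finite (T k)" if "k \<in> E" for k
    using assms(3)[OF that] ends[OF that] by (auto simp: S_def T_def)
  have unit: "unit_vector (Pi\<^sub>E (ends k) (\<lambda>i. B i k)) (\<psi> k)" if "k \<in> E" for k
    using assms(4)[OF that] by (simp add: pure_entangled_def)
  have "\<exists>h > 0. \<forall>\<delta> > 0. \<exists>N a b.
      h \<le> Re (pair_expval (S k) (T k) (\<Psi> k) (proj_on (S k) (a 0)) (proj_on (T k) (b 0))) \<and>
      pair_chain (S k) (T k) (\<Psi> k) (\<lambda>m. proj_on (S k) (a m)) (\<lambda>m. proj_on (T k) (b m)) N \<le> \<delta>"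
    if k: "k \<in> E" for k
  proof (rule entangled_chain[OF fin[OF k]])
    show "\<nexists>u w. \<forall>s \<in> S k. \<forall>t \<in> T k. \<Psi> k s t = u s * w t"
      using pure_entangled_pair[of "src k" "dst k" "\<lambda>i. B i k" "\<psi> k"] assms(4)[OF k] ends[OF k]
      by (simp add: S_def T_def \<Psi>_def)
  qed
  then obtain h where h: "\<And>k. k \<in> E \<Longrightarrow> 0 < h k"
    and chain: "\<And>k \<delta>. k \<in> E \<Longrightarrow> 0 < \<delta> \<Longrightarrow> \<exists>N a b.
      h k \<le> Re (pair_expval (S k) (T k) (\<Psi> k) (proj_on (S k) (a 0)) (proj_on (T k) (b 0))) \<and>
      pair_chain (S k) (T k) (\<Psi> k) (\<lambda>m. proj_on (S k) (a m)) (\<lambda>m. proj_on (T k) (b m)) N \<le> \<delta>"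
    by metis
  define p where "p = (\<Prod>k \<in> E. h k)"
  \<comment> \<open>The added 1 makes the total error \<open>card E * \<delta>\<close> strictly
    smaller than \<open>p\<close>.\<close>
  define \<delta> where "\<delta> = p / (real (card E) + 1)"
  have p: "0 < p" unfolding p_def by (rule prod_pos) (simp add: h)
  then have \<delta>: "0 < \<delta>" by (simp add: \<delta>_def)
  have "\<forall>k \<in> E. \<exists>N a b.
      h k \<le> Re (pair_expval (S k) (T k) (\<Psi> k) (proj_on (S k) (a 0)) (proj_on (T k) (b 0))) \<and>
      pair_chain (S k) (T k) (\<Psi> k) (\<lambda>m. proj_on (S k) (a m)) (\<lambda>m. proj_on (T k) (b m)) N \<le> \<delta>"
    using chain \<delta> by blast
  then obtain N a b where
    succ: "\<And>k. k \<in> E \<Longrightarrow>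
      h k \<le> Re (pair_expval (S k) (T k) (\<Psi> k) (proj_on (S k) (a k 0)) (proj_on (T k) (b k 0)))"
    and err: "\<And>k. k \<in> E \<Longrightarrow> pair_chain (S k) (T k) (\<Psi> k)
      (\<lambda>m. proj_on (S k) (a k m)) (\<lambda>m. proj_on (T k) (b k m)) (N k) \<le> \<delta>"
    by metis

  \<comment> \<open>Inputs are naturals, so edges are numbered in order to encode an edge and an
    index in one input.\<close>
  obtain g :: "'e \<Rightarrow> nat" where g: "inj_on g E"
    using finite_imp_inj_to_nat_seg[OF finE] by blast
  define P where "P v k m = (if v = src k then proj_on (S k) (a k m) else proj_on (T k) (b k m))"
    for v k and m :: nat
  \<comment> \<open>Input \<open>0\<close> projects all edges on their first vectors; input \<open>inp k (Suc m)\<close> only measures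
    edge \<open>k\<close>, with its vector number \<open>Suc m\<close>. Output \<open>0\<close> means that all these projections
    succeed.\<close>
  define inp where "inp k m = (case m of 0 \<Rightarrow> 0 | Suc m' \<Rightarrow> Suc (prod_encode (g k, m')))" for k m
  \<comment> \<open>The effect on edge \<open>k\<close> after decoding the input. All parties share
    one input set; on an input for an edge not incident to it, a party measures the identity and
    outputs 0.\<close>
  define G where "G \<chi> v k = (case \<chi> of 0 \<Rightarrow> P v k 0 | Suc \<chi>' \<Rightarrow>
    if fst (prod_decode \<chi>') = g k then P v k (Suc (snd (prod_decode \<chi>'))) else id_op)" for \<chi> v k
  define F where "F v \<chi> = (\<lambda>\<alpha> :: nat. if \<alpha> = 0 then tensor_op (incident_edges E ends v) (G \<chi> v)
    else diff_op id_op (tensor_op (incident_edges E ends v) (G \<chi> v)))" for v \<chi>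
  define X where "X = insert 0 (\<Union>k \<in> E. inp k ` {..N k})"
  have inp0: "inp k 0 = 0" for k by (simp add: inp_def)
  have inpX: "inp k m \<in> X" if "k \<in> E" "m \<le> N k" for k m
    using that by (auto simp: X_def)
  let ?\<rho> = "projector (network_state E ends \<psi>)"
  let ?z = "\<lambda>v \<in> ?V. 0 :: nat"
  have P: "is_projection (B v k) (P v k m)" if "k \<in> E" "v \<in> ends k" for v k m
    using ends[OF that(1)] fin[OF that(1)] that(2)
    by (auto simp: P_def S_def T_def intro!: is_projection_proj_on)
  have G: "is_projection (B v k) (G \<chi> v k)" if "k \<in> E" "v \<in> ends k" for \<chi> v k
    using P[OF that] is_projection_id_op[OF assms(3)[OF that]]
    by (simp add: G_def split: nat.split)
  have G_inp: "G (inp k m) v k = P v k m" for k m v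
    by (cases m) (simp_all add: G_def inp_def)
  have G_other: "G (inp k m) v k' = id_op" if "k \<in> E" "k' \<in> E" "k' \<noteq> k" "m \<noteq> 0" for k k' m v
    using that inj_on_eq_iff[OF g, of k k'] by (cases m) (simp_all add: G_def inp_def)
  have fininc: "finite (incident_edges E ends v)" for v
    using finE by (simp add: incident_edges_def)
  have finH: "finite (?H v)" for v
    unfolding party_space_def by (intro finite_PiE fininc) (auto simp: incident_edges_def assms(3))
  have povm: "povm (?H v) {0, 1} (F v \<chi>)" for v \<chi>
    unfolding F_def
  proof (rule povm_binary_projection[OF finH])
    show "is_projection (?H v) (tensor_op (incident_edges E ends v) (G \<chi> v))"
      unfolding party_space_def
      by (intro is_projection_tensor_op fininc) (auto simp: incident_edges_def assms(3) G)
  qed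

  have F_sum: "F v \<chi> 0 y z + F v \<chi> 1 y z = id_op y z" for v \<chi> y z
    by (simp add: F_def diff_op_def)

  \<comment> \<open>At index 0 the other edges are projected too, which can only lower the
    probability of output 0. At a positive index they are left alone, so output 1 means failure of
    edge \<open>k\<close> itself.\<close>
  have bound: "pair_prob ?V (\<lambda>_. {0, 1}) (src k) (dst k) \<alpha> \<beta> (born_dist ?V ?H F ?\<rho>)
      (?z(src k := inp k m, dst k := inp k m')) \<le> Re (pair_expval (S k) (T k) (\<Psi> k)
        (if \<alpha> = 0 then proj_on (S k) (a k m) else diff_op id_op (proj_on (S k) (a k m)))
        (if \<beta> = 0 then proj_on (T k) (b k m') else diff_op id_op (proj_on (T k) (b k m'))))"
    if k: "k \<in> E" and \<alpha>: "\<alpha> \<le> 1" "\<alpha> = 1 \<longrightarrow> m \<noteq> 0" and \<beta>: "\<beta> \<le> 1" "\<beta> = 1 \<longrightarrow> m' \<noteq> 0"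
    for k \<alpha> \<beta> m m'
  proof -
    define R where "R v \<alpha> m = (G (inp k m) v)(k := if \<alpha> = 0 then P v k m else diff_op id_op (P v k m))"
      for v and \<alpha> m :: nat
    have R: "is_projection (B v k') (R v \<alpha> m k')" if "k' \<in> E" "v \<in> ends k'" for v k' \<alpha> m
      using G[OF that] P[OF that] is_projection_complement[OF assms(3)[OF that]]
      by (auto simp: R_def)
    have FR: "F v (inp k m) \<alpha> y z = tensor_op (incident_edges E ends v) (R v \<alpha> m) y z"
      if "v \<in> ends k" "y \<in> ?H v" "z \<in> ?H v" "\<alpha> = 0 \<or> \<alpha> = 1 \<and> m \<noteq> 0" for v y z \<alpha> m
    proof (cases "\<alpha> = 0")
      case True
      have "R v \<alpha> m = G (inp k m) v" using True by (simp add: R_def fun_eq_iff G_inp)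
      then show ?thesis using True by (simp add: F_def)
    next
      case False
      have "diff_op id_op (tensor_op (incident_edges E ends v) (G (inp k m) v)) y z =
          tensor_op (incident_edges E ends v)
            ((G (inp k m) v)(k := diff_op id_op (G (inp k m) v k))) y z"
        using that False k
        by (intro complement_tensor_op[OF fininc _ that(2,3)[unfolded party_space_def]])
          (auto simp: incident_edges_def G_other)
      then show ?thesis using False by (simp add: F_def R_def G_inp)
    qed
    note e = ends[OF k]
    have sd: "src k \<in> ?V" "dst k \<in> ?V" "src k \<noteq> dst k" using e by auto
    have x: "(?z(src k := inp k m, dst k := inp k m')) (src k) = inp k m"
      "(?z(src k := inp k m, dst k := inp k m')) (dst k) = inp k m'"
      using sd(3) by simp_all
    have "pair_prob ?V (\<lambda>_. {0, 1}) (src k) (dst k) \<alpha> \<beta> (born_dist ?V ?H F ?\<rho>)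
        (?z(src k := inp k m, dst k := inp k m')) =
      Re (expval (Pi\<^sub>E ?V ?H) (tensor_op ?V ((\<lambda>_. id_op)
        (src k := F (src k) (inp k m) \<alpha>, dst k := F (dst k) (inp k m') \<beta>))) (network_state E ends \<psi>))"
      unfolding pair_prob_born[OF finite_atLeastAtMost sd \<alpha>(1) \<beta>(1) F_sum] x ..
    also have "\<dots> \<le> Re (pair_expval (S k) (T k) (\<Psi> k) (R (src k) \<alpha> m k) (R (dst k) \<beta> m' k))"
      unfolding S_def T_def \<Psi>_def
    proof (rule network_expval_le_edge[where X = "R (src k) \<alpha> m" and Y = "R (dst k) \<beta> m'",
          OF graph assms(3) unit k])
      show "ends k = {src k, dst k}" "src k \<noteq> dst k" using e by auto
    next
      fix y z assume yz: "y \<in> ?H (src k)" "z \<in> ?H (src k)"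
      show "F (src k) (inp k m) \<alpha> y z = tensor_op (incident_edges E ends (src k)) (R (src k) \<alpha> m) y z"
        by (rule FR[OF _ yz]) (use e \<alpha> in auto)
    next
      fix y z assume yz: "y \<in> ?H (dst k)" "z \<in> ?H (dst k)"
      show "F (dst k) (inp k m') \<beta> y z = tensor_op (incident_edges E ends (dst k)) (R (dst k) \<beta> m') y z"
        by (rule FR[OF _ yz]) (use e \<beta> in auto)
    qed (assumption | rule R)+
    finally have "pair_prob ?V (\<lambda>_. {0, 1}) (src k) (dst k) \<alpha> \<beta> (born_dist ?V ?H F ?\<rho>)
        (?z(src k := inp k m, dst k := inp k m')) \<le>
      Re (pair_expval (S k) (T k) (\<Psi> k) (R (src k) \<alpha> m k) (R (dst k) \<beta> m' k))" .
    moreover have "R (src k) \<alpha> m k =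
        (if \<alpha> = 0 then proj_on (S k) (a k m) else diff_op id_op (proj_on (S k) (a k m)))"
      by (simp add: R_def P_def)
    moreover have "R (dst k) \<beta> m' k =
        (if \<beta> = 0 then proj_on (T k) (b k m') else diff_op id_op (proj_on (T k) (b k m')))"
      using e by (simp add: R_def P_def)
    ultimately show ?thesis by (simp only:)
  qed

  have "\<not> bilocal_decomposable ?V (\<lambda>_. {0, 1}) (\<lambda>_. X) (born_dist ?V ?H F ?\<rho>)"
  proof (rule not_bilocal_decomposable[where E = E and ends = ends and src = src and dst = dst
        and inp = inp and N = N and z = ?z])
    show "\<exists>k \<in> E. ends k \<inter> M \<noteq> {} \<and> ends k - M \<noteq> {}" if "M \<in> proper_parts ?V" for M
      by (rule connected_graph_cut[OF assms(2) that])
    have "(\<Sum>k \<in> E. chain_error (N k) (\<lambda>\<alpha> \<beta> m m'.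
        pair_prob ?V (\<lambda>_. {0, 1}) (src k) (dst k) \<alpha> \<beta> (born_dist ?V ?H F ?\<rho>)
          (?z(src k := inp k m, dst k := inp k m')))) \<le> (\<Sum>k \<in> E. \<delta>)"
    proof (rule sum_mono)
      fix k assume k: "k \<in> E"
      show "chain_error (N k) (\<lambda>\<alpha> \<beta> m m'.
          pair_prob ?V (\<lambda>_. {0, 1}) (src k) (dst k) \<alpha> \<beta> (born_dist ?V ?H F ?\<rho>)
            (?z(src k := inp k m, dst k := inp k m'))) \<le> \<delta>"
        by (rule order_trans[OF chain_error_mono err[OF k, unfolded pair_chain_def]])
          (rule bound[OF k])
    qed
    also have "\<dots> < p" using p by (simp add: \<delta>_def field_simps)
    \<comment> \<open>On the all-zero input, the all-zero output is success on every edge at once,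
      and its probability is the product of the edge success probabilities.\<close>
    also have "p \<le> born_dist ?V ?H F ?\<rho> ?z ?z"
    proof -
      have "expval (Pi\<^sub>E ?V ?H) (tensor_op ?V (\<lambda>v. F v (?z v) (?z v))) (network_state E ends \<psi>) =
          expval (Pi\<^sub>E ?V ?H) (tensor_op ?V (\<lambda>v. tensor_op (incident_edges E ends v) (G 0 v)))
            (network_state E ends \<psi>)"
        by (rule expval_cong[OF tensor_op_cong refl]) (simp add: F_def)
      also have "\<dots> = (\<Prod>k \<in> E. expval (Pi\<^sub>E (ends k) (\<lambda>i. B i k))
          (tensor_op (ends k) (\<lambda>v. G 0 v k)) (\<psi> k))"
        by (rule network_expval[OF graph assms(3)])
      also have "\<dots> = (\<Prod>k \<in> E. of_real (Re (pair_expval (S k) (T k) (\<Psi> k)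
          (proj_on (S k) (a k 0)) (proj_on (T k) (b k 0)))))"
      proof (rule prod.cong[OF refl])
        fix k assume k: "k \<in> E"
        have "expval (Pi\<^sub>E (ends k) (\<lambda>i. B i k)) (tensor_op (ends k) (\<lambda>v. G 0 v k)) (\<psi> k) =
            pair_expval (S k) (T k) (\<Psi> k) (proj_on (S k) (a k 0)) (proj_on (T k) (b k 0))"
          using ends[OF k] expval_pair[of "src k" "dst k" "\<lambda>i. B i k" "\<lambda>v. G 0 v k" "\<psi> k"]
          by (simp add: S_def T_def \<Psi>_def G_def P_def)
        then show "expval (Pi\<^sub>E (ends k) (\<lambda>i. B i k)) (tensor_op (ends k) (\<lambda>v. G 0 v k)) (\<psi> k) =
            of_real (Re (pair_expval (S k) (T k) (\<Psi> k) (proj_on (S k) (a k 0)) (proj_on (T k) (b k 0))))"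
          by (simp only: pair_expval_proj_proj Re_complex_of_real)
      qed
      finally have "born_dist ?V ?H F ?\<rho> ?z ?z = (\<Prod>k \<in> E. Re (pair_expval (S k) (T k) (\<Psi> k)
          (proj_on (S k) (a k 0)) (proj_on (T k) (b k 0))))"
        by (simp only: born_dist_projector of_real_prod[symmetric] Re_complex_of_real)
      then show ?thesis
        unfolding p_def by (simp only:) (intro prod_mono conjI less_imp_le[OF h] succ)
    qed
    finally show "(\<Sum>k \<in> E. chain_error (N k) (\<lambda>\<alpha> \<beta> m m'.
        pair_prob ?V (\<lambda>_. {0, 1}) (src k) (dst k) \<alpha> \<beta> (born_dist ?V ?H F ?\<rho>)
          (?z(src k := inp k m, dst k := inp k m')))) < born_dist ?V ?H F ?\<rho> ?z ?z" .
  qed (use finE ends inpX in \<open>simp_all add: X_def inp0\<close>)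
  moreover have "finite X" "X \<noteq> {}" using finE by (auto simp: X_def)
  ultimately show ?thesis
    unfolding GMNL_state_def GMNL_dist_def using povm
    by (intro exI[of _ "\<lambda>_. {0, 1}"] exI[of _ "\<lambda>_. X"] exI[of _ F]) auto
qed

end
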